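(* Let $k$ be a field, $n,d\ge1$ integers, $S=k[x_1,\dots,x_n]$, $\widetilde S=k[x_{ij}\mid 1\le i\le n,\ 1\le j\le d]$, and $F$ a free module of rank $n$ with basis $f_1,\dots,f_n$ over a polynomial ring over $k$. Let $\chi=\{X_i\}_{1\le i\le n}$ be a set of rank-preserving isotone maps $X_i:(\Delta^{\mathbb Z}(n,d),\le_i)\to\mathcal B_d$. Then the following are equivalent: 1. The elements of $\mathrm{tab}(\chi)$ span the module $L^1_d(F)$. 2. For every $\mathbf c\in\Delta^{\mathbb Z}(n,d+1)$, the set $\mathrm{LS}(\mathbf c)$ of linear syzygy edges contains a spanning tree of the complete down-graph $D(\mathbf c)$. 3. The isotone maps $X_1,\dots,X_n$ determine a polarization of $(x_1,\dots,x_n)^d$.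
   Context: **Lattice points and orders.** $\Delta^{\mathbb Z}(n,d)$ is the set of $\mathbf a\in\mathbb Z_{\ge0}^n$ with $\sum a_i=d$. For fixed $i$, the partial order $\ge_i$ on $\Delta^{\mathbb Z}(n,d)$ is: $\mathbf b\ge_i\mathbf a$ iff $b_i\ge a_i$ and $b_j\le a_j$ for all $j\ne i$. It is graded, with $\mathbf a$ of rank $a_i$. $\mathcal B_d$ is the Boolean poset of subsets of $[d]=\{1,\dots,d\}$ (rank = cardinality). Isotone means order preserving; rank-preserving means $|X_i(\mathbf a)|=a_i$. $\epsilon_i$ is the $i$th unit vector; $\operatorname{Supp}(\mathbf c)=\{i: c_i>0\}$. **Ideal determined by $\chi$.** For $\mathbf a\in\Delta^{\mathbb Z}(n,d)$ let $m_i(\mathbf a)=\prod_{j\in X_i(\mathbf a)}x_{ij}$ and $m(\mathbf a)=\prod_{i=1}^n m_i(\mathbf a)$; let $J\subset\widetilde S$ be the ideal generated by all $m(\mathbf a)$. "The maps determine a polarization of $I$" means that $J$ is a polarization of $I$. **Polarization.** An ideal $\widetilde I\subset\widetilde S$ is a polarization of a monomial ideal $I\subset S$ if $\sigma=\bigcup_{i=1}^n\{x_{i1}-x_{i2},x_{i1}-x_{i3},\dots,x_{i1}-x_{id}\}$ is a regular $\widetilde S/\widetilde I$-sequence and $\widetilde I\otimes\widetilde S/\langle\sigma\rangle\cong I$ (i.e. setting $x_{ij}\mapsto x_i$ identifies $\widetilde S/\langle\sigma\rangle$ with $S$ and carries $\widetilde I$ to $I$). **Down-graphs and linear syzygy edges.**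 For $\mathbf c\in\Delta^{\mathbb Z}(n,d+1)$ and distinct $i,j\in\operatorname{Supp}(\mathbf c)$, $(\mathbf c;i,j)$ denotes the edge between $\mathbf c-\epsilon_i$ and $\mathbf c-\epsilon_j$. The complete down-graph $D(\mathbf c)$ is the complete graph on the points $\mathbf c-\epsilon_i$, $i\in\operatorname{Supp}(\mathbf c)$. The edge $(\mathbf c;i,j)$ is a linear syzygy edge if there is a monomial $\mathbf m$ of degree $d-1$ with $m(\mathbf c-\epsilon_i)=x_{jr}\mathbf m$ and $m(\mathbf c-\epsilon_j)=x_{is}\mathbf m$ for some $r,s$; equivalently $X_p(\mathbf c-\epsilon_i)=X_p(\mathbf c-\epsilon_j)$ for all $p\ne i,j$. $\mathrm{LS}(\mathbf c)$ is the set of linear syzygy edges in $D(\mathbf c)$. **Tableaux and the Schur module.** $S_b(F)$ is the $b$th symmetric power, $f^{\mathbf a}=f_1^{a_1}\cdots f_n^{a_n}$, and $\kappa_{a,b}:\bigwedge^aF\otimes S_b(F)\to\bigwedge^{a-1}F\otimes S_{b+1}(F)$ is comultiplication $\bigwedge^aF\to\bigwedge^{a-1}F\otimes F$ followed by multiplication $F\otimes S_b(F)\to S_{b+1}(F)$. $L^a_b(F)=\ker\kappa_{a,b}$, which is identified with the cokernel of $\kappa_{a+2,b-2}:\bigwedge^{a+2}F\otimes S_{b-2}(F)\to\bigwedge^{a+1}F\otimes S_{b-1}(F)$ via $\kappa_{a+1,b-1}$. Elements of $\bigwedge^2F\otimes S_{d-1}(F)$ are viewed in $L^1_d(F)$ via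 $\kappa_{2,d-1}$. $\mathrm{tab}(\chi)$ is the set of elements (hook tableaux) $f_i\wedge f_j\otimes f^{\mathbf c-\epsilon_i-\epsilon_j}$ with $i<j$, for all $\mathbf c\in\Delta^{\mathbb Z}(n,d+1)$ and all $(\mathbf c;i,j)\in\mathrm{LS}(\mathbf c)$; "span" refers to their images in $L^1_d(F)$. *)

theory Defs
  imports Complex_Main "HOL-Library.Cardinality" "HOL-Library.Poly_Mapping"
begin

text \<open>
  The numbers \<open>n\<close> and \<open>d\<close> are the cardinalities of the index types \<open>'n\<close> and \<open>'d\<close>, so both are
  positive; \<open>UNIV :: 'n set\<close> and \<open>UNIV :: 'd set\<close> play the roles of \<open>{1..n}\<close> and \<open>{1..d}\<close>, with
  the linear order of the type as the order of the indices.
\<close>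

section \<open>Polynomial rings and ideals\<close>

type_synonym ('v, 'k) mpoly = "('v \<Rightarrow>\<^sub>0 nat) \<Rightarrow>\<^sub>0 'k"

definition mon :: "('v \<Rightarrow>\<^sub>0 nat) \<Rightarrow> ('v, 'k::comm_ring_1) mpoly" where
  "mon u = Poly_Mapping.single u 1"

definition var :: "'v \<Rightarrow> ('v, 'k::comm_ring_1) mpoly" where
  "var v = mon (Poly_Mapping.single v 1)"

definition const :: "'k::comm_ring_1 \<Rightarrow> ('v, 'k) mpoly" where
  "const r = Poly_Mapping.single 0 r"

definition mdeg :: "('v \<Rightarrow>\<^sub>0 nat) \<Rightarrow> nat" where
  "mdeg u = (\<Sum>v\<in>Poly_Mapping.keys u. Poly_Mapping.lookup u v)"

definition subst :: "('v \<Rightarrow> ('w, 'k) mpoly) \<Rightarrow> ('v, 'k::comm_ring_1) mpoly \<Rightarrow> ('w, 'k) mpoly" where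
  "subst \<phi> p = (\<Sum>u\<in>Poly_Mapping.keys p. const (Poly_Mapping.lookup p u) *
     (\<Prod>v\<in>Poly_Mapping.keys u. \<phi> v ^ Poly_Mapping.lookup u v))"

lemma module_mult: "module ((*) :: 'a::comm_ring_1 \<Rightarrow> 'a \<Rightarrow> 'a)"
  by standard (simp_all add: algebra_simps)

definition ideal_gen :: "'a::comm_ring_1 set \<Rightarrow> 'a set" where
  "ideal_gen = module.span (*)"

primrec ideal_power :: "'a::comm_ring_1 set \<Rightarrow> nat \<Rightarrow> 'a set" where
  "ideal_power I 0 = UNIV"
| "ideal_power I (Suc k) = ideal_gen {a * b | a b. a \<in> I \<and> b \<in> ideal_power I k}"

section \<open>Polarizations\<close>

text \<open>\<open>rs\<close> is a regular sequence on the module \<open>R/I\<close>: each entry is a nonzerodivisor on the quotient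
  of \<open>R/I\<close> by the preceding entries, which is \<open>R\<close> modulo the ideal generated by \<open>I\<close> and the
  preceding entries, and the quotient by all entries is nonzero.\<close>

definition regular_on_quotient :: "'a::comm_ring_1 set \<Rightarrow> 'a list \<Rightarrow> bool" where
  "regular_on_quotient I rs \<longleftrightarrow>
     (\<forall>k < length rs. \<forall>y. rs ! k * y \<in> ideal_gen (I \<union> set (take k rs))
        \<longrightarrow> y \<in> ideal_gen (I \<union> set (take k rs))) \<and>
     ideal_gen (I \<union> set rs) \<noteq> UNIV"

text \<open>The differences \<open>x\<^sub>i\<^sub>1 - x\<^sub>i\<^sub>j\<close> for \<open>j > 1\<close>, listed in lexicographic order of \<open>(i, j)\<close>.\<close>

definition sigma :: "('n::{finite,linorder} \<times> 'd::{finite,linorder}, 'k::comm_ring_1) mpoly list" where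
  "sigma = concat (map (\<lambda>i. map (\<lambda>j. var (i, Min UNIV) - var (i, j))
       (sorted_list_of_set (UNIV - {Min UNIV})))
     (sorted_list_of_set UNIV))"

definition depolarize :: "('n \<times> 'd, 'k::comm_ring_1) mpoly \<Rightarrow> ('n, 'k) mpoly" where
  "depolarize = subst (\<lambda>(i, j). var i)"

text \<open>\<open>depolarize\<close> is a surjective ring homomorphism with kernel the ideal generated by \<open>sigma\<close>, and
  so identifies the quotient with the polynomial ring in the \<open>x\<^sub>i\<close>.\<close>

definition is_polarization ::
    "('n::{finite,linorder} \<times> 'd::{finite,linorder}, 'k::comm_ring_1) mpoly set
      \<Rightarrow> ('n, 'k) mpoly set \<Rightarrow> bool" where
  "is_polarization I' I \<longleftrightarrow> regular_on_quotient I' sigma \<and> depolarize ` I' = I"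

section \<open>Lattice points and isotone maps\<close>

definition Delta :: "nat \<Rightarrow> ('n::finite \<Rightarrow>\<^sub>0 nat) set" where
  "Delta d = {a. (\<Sum>i\<in>UNIV. Poly_Mapping.lookup a i) = d}"

abbreviation eps :: "'n \<Rightarrow> 'n \<Rightarrow>\<^sub>0 nat" where
  "eps i \<equiv> Poly_Mapping.single i 1"

abbreviation Supp :: "('n \<Rightarrow>\<^sub>0 nat) \<Rightarrow> 'n set" where
  "Supp c \<equiv> Poly_Mapping.keys c"

definition le_at :: "'n \<Rightarrow> ('n \<Rightarrow>\<^sub>0 nat) \<Rightarrow> ('n \<Rightarrow>\<^sub>0 nat) \<Rightarrow> bool" where
  "le_at i a b \<longleftrightarrow> Poly_Mapping.lookup a i \<le> Poly_Mapping.lookup b i \<and>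
     (\<forall>j. j \<noteq> i \<longrightarrow> Poly_Mapping.lookup b j \<le> Poly_Mapping.lookup a j)"

definition rank_preserving_isotone ::
    "'n::finite \<Rightarrow> (('n \<Rightarrow>\<^sub>0 nat) \<Rightarrow> 'd::finite set) \<Rightarrow> bool" where
  "rank_preserving_isotone i Y \<longleftrightarrow>
     monotone_on (Delta CARD('d)) (le_at i) (\<subseteq>) Y \<and>
     (\<forall>a\<in>Delta CARD('d). card (Y a) = Poly_Mapping.lookup a i)"

text \<open>Monomials are represented by their exponent vectors, so that products of monomials become
  sums; the corresponding polynomial is obtained by \<open>mon\<close>.\<close>

definition m_exp :: "('n::finite \<Rightarrow> ('n \<Rightarrow>\<^sub>0 nat) \<Rightarrow> 'd set) \<Rightarrow> ('n \<Rightarrow>\<^sub>0 nat) \<Rightarrow> ('n \<times> 'd) \<Rightarrow>\<^sub>0 nat" where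
  "m_exp X a = (\<Sum>i\<in>UNIV. \<Sum>j\<in>X i a. Poly_Mapping.single (i, j) 1)"

definition J_ideal ::
    "('n::finite \<Rightarrow> ('n \<Rightarrow>\<^sub>0 nat) \<Rightarrow> 'd::finite set) \<Rightarrow> ('n \<times> 'd, 'k::comm_ring_1) mpoly set" where
  "J_ideal X = ideal_gen {mon (m_exp X a) | a. a \<in> Delta CARD('d)}"

section \<open>Down-graphs and linear syzygy edges\<close>

text \<open>An undirected simple graph is given by a vertex set and a set of two-element sets of vertices.
  (The trees of the AFP entry Graph Theory are defined by excluding directed cycles only.)\<close>

definition graph_connected :: "'a set \<Rightarrow> 'a set set \<Rightarrow> bool" where
  "graph_connected V E \<longleftrightarrow> V \<noteq> {} \<and> (\<forall>u\<in>V. \<forall>v\<in>V. (u, v) \<in> {(x, y). {x, y} \<in> E}\<^sup>*)"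

definition graph_cycle :: "'a set set \<Rightarrow> 'a list \<Rightarrow> bool" where
  "graph_cycle E p \<longleftrightarrow> length p \<ge> 3 \<and> distinct p \<and>
     (\<forall>t < length p. {p ! t, p ! (Suc t mod length p)} \<in> E)"

definition spanning_tree :: "'a set \<Rightarrow> 'a set set \<Rightarrow> 'a set set \<Rightarrow> bool" where
  "spanning_tree V E T \<longleftrightarrow> T \<subseteq> E \<and> graph_connected V T \<and> (\<nexists>p. graph_cycle T p)"

definition down_verts :: "('n \<Rightarrow>\<^sub>0 nat) \<Rightarrow> ('n \<Rightarrow>\<^sub>0 nat) set" where
  "down_verts c = {c - eps i | i. i \<in> Supp c}"

definition down_edges :: "('n \<Rightarrow>\<^sub>0 nat) \<Rightarrow> ('n \<Rightarrow>\<^sub>0 nat) set set" where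
  "down_edges c = {{c - eps i, c - eps j} | i j. i \<in> Supp c \<and> j \<in> Supp c \<and> i \<noteq> j}"

definition is_linear_syzygy ::
    "('n::finite \<Rightarrow> ('n \<Rightarrow>\<^sub>0 nat) \<Rightarrow> 'd::finite set) \<Rightarrow> ('n \<Rightarrow>\<^sub>0 nat) \<Rightarrow> 'n \<Rightarrow> 'n \<Rightarrow> bool" where
  "is_linear_syzygy X c i j \<longleftrightarrow>
     (\<exists>u r s. mdeg u = CARD('d) - 1 \<and>
        m_exp X (c - eps i) = Poly_Mapping.single (j, r) 1 + u \<and>
        m_exp X (c - eps j) = Poly_Mapping.single (i, s) 1 + u)"

definition LS ::
    "('n::finite \<Rightarrow> ('n \<Rightarrow>\<^sub>0 nat) \<Rightarrow> 'd::finite set) \<Rightarrow> ('n \<Rightarrow>\<^sub>0 nat) \<Rightarrow> ('n \<Rightarrow>\<^sub>0 nat) set set" where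
  "LS X c = {{c - eps i, c - eps j} | i j.
     i \<in> Supp c \<and> j \<in> Supp c \<and> i \<noteq> j \<and> is_linear_syzygy X c i j}"

section \<open>The Schur module\<close>

text \<open>Let \<open>F\<close> be the free module with basis \<open>f\<^sub>i\<close>, \<open>i :: 'n\<close>, over a commutative ring \<open>R\<close>. Its symmetric
  algebra is the polynomial ring over \<open>R\<close> in the \<open>f\<^sub>i\<close>, with \<open>var i\<close> for \<open>f\<^sub>i\<close>, and its exterior
  algebra is free on the products \<open>f\<^sub>A\<close>, \<open>A \<subseteq> UNIV\<close>, of the \<open>f\<^sub>i\<close> with \<open>i \<in> A\<close> in increasing order.
  An element \<open>x\<close> of the following type stands for the sum of the tensors of \<open>f\<^sub>A\<close> with the
  coefficient of \<open>x\<close> at \<open>A\<close>, in the tensor product of the exterior and the symmetric algebra.\<close>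

type_synonym ('n, 'r) ext_sym = "'n set \<Rightarrow>\<^sub>0 ('n, 'r) mpoly"

definition scale :: "'r::comm_ring_1 \<Rightarrow> ('n, 'r) ext_sym \<Rightarrow> ('n, 'r) ext_sym" where
  "scale r x = Poly_Mapping.map ((*) (const r)) x"

lemma lookup_scale: "Poly_Mapping.lookup (scale r x) A = const r * Poly_Mapping.lookup x A"
  by (simp add: scale_def Poly_Mapping.map.rep_eq when_def)

lemma module_scale: "module (scale :: 'r::comm_ring_1 \<Rightarrow> ('n, 'r) ext_sym \<Rightarrow> _)"
proof -
  have const: "const (r + s) = const r + const s" "const (r * s) = const r * const s" "const 1 = 1"
    for r s :: 'r
    by (simp_all add: const_def single_add mult_single)
  show ?thesis
    by standard
      (rule poly_mapping_eqI, simp add: lookup_scale lookup_add const distrib_left distrib_right mult.assoc)+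
qed

text \<open>The summand formed from the exterior power of degree \<open>a\<close> and the symmetric power of degree \<open>b\<close>.\<close>

definition ext_sym_part :: "nat \<Rightarrow> nat \<Rightarrow> ('n, 'r::comm_ring_1) ext_sym set" where
  "ext_sym_part a b = {x. \<forall>A\<in>Poly_Mapping.keys x. card A = a \<and>
     (\<forall>u\<in>Poly_Mapping.keys (Poly_Mapping.lookup x A). mdeg u = b)}"

text \<open>The sum of the maps \<open>\<kappa>\<^sub>a\<^sub>,\<^sub>b\<close>. Comultiplication sends \<open>f\<^sub>A\<close> to the sum over \<open>i \<in> A\<close> of the tensors
  of \<open>f\<^sub>A\<^sub>-\<^sub>i\<close> with \<open>f\<^sub>i\<close>, where the sign comes from moving \<open>f\<^sub>i\<close> to the last position of \<open>f\<^sub>A\<close>.\<close>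

definition kappa ::
    "('n::{finite,linorder}, 'r::comm_ring_1) ext_sym \<Rightarrow> ('n, 'r) ext_sym" where
  "kappa x = (\<Sum>A\<in>UNIV. \<Sum>i\<in>A. Poly_Mapping.single (A - {i})
     ((-1) ^ card {j\<in>A. i < j} * (var i * Poly_Mapping.lookup x A)))"

definition schur_L :: "nat \<Rightarrow> nat \<Rightarrow> ('n::{finite,linorder}, 'r::comm_ring_1) ext_sym set" where
  "schur_L a b = {x \<in> ext_sym_part a b. kappa x = 0}"

text \<open>The hook tableau (standard basis element) \<open>f\<^sub>i \<and> f\<^sub>j \<otimes> f\<^sup>u\<close>, for \<open>i < j\<close>.\<close>

definition hook :: "'n::linorder \<Rightarrow> 'n \<Rightarrow> ('n \<Rightarrow>\<^sub>0 nat) \<Rightarrow> ('n, 'r::comm_ring_1) ext_sym" where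
  "hook i j u = Poly_Mapping.single {i, j} (mon u)"

definition tab ::
    "('n::{finite,linorder} \<Rightarrow> ('n \<Rightarrow>\<^sub>0 nat) \<Rightarrow> 'd::finite set) \<Rightarrow> ('n, 'r::comm_ring_1) ext_sym set" where
  "tab X = {hook i j (c - eps i - eps j) | c i j.
     c \<in> Delta (CARD('d) + 1) \<and> i \<in> Supp c \<and> j \<in> Supp c \<and> i < j \<and>
     {c - eps i, c - eps j} \<in> LS X c}"

text \<open>The span of the image of \<open>tab X\<close> in the Schur module, via \<open>kappa\<close>.\<close>

definition tab_span ::
    "('n::{finite,linorder} \<Rightarrow> ('n \<Rightarrow>\<^sub>0 nat) \<Rightarrow> 'd::finite set) \<Rightarrow> ('n, 'r::comm_ring_1) ext_sym set" where
  "tab_span X = module.span scale (kappa ` tab X)"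

end

theory Submission
  imports Defs
begin

text \<open>
  Both equivalences factor through the connectedness of all graphs \<open>LS X c\<close>. In the Schur module, the
  part of degree \<open>c\<close> of the kernel of \<open>kappa\<close> consists of the families of coefficients on the vertices
  of the down-graph with sum zero, and such families are spanned by the differences along the edges
  of a graph on these vertices iff the graph is connected.

  For polarizations, let \<open>J\<close> be the ideal of the maps and \<open>\<sigma>\<close> the sequence of differences of
  variables, which is regular on the polynomial ring. Then \<open>\<sigma>\<close> is regular on the quotient by \<open>J\<close> iff
  \<open>J \<inter> \<langle>\<sigma>\<rangle> = \<langle>\<sigma>\<rangle> J\<close>, where the implication from right to left is graded rigidity of \<open>Tor\<close>, proved by
  removing the entries of \<open>\<sigma>\<close> one at a time with Nakayama's lemma. If the graphs are connected, the
  linear syzygies carry every multiple of a generator of \<open>J\<close>, modulo \<open>\<langle>\<sigma>\<rangle> J\<close>, to a representative that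
  depends only on its depolarization, so an element of \<open>J\<close> with depolarization zero lies in
  \<open>\<langle>\<sigma>\<rangle> J\<close>. If some graph is disconnected, the sum of the coefficients of the monomials arising from one
  component is a linear functional that separates \<open>\<langle>\<sigma>\<rangle> J\<close> from \<open>J \<inter> \<langle>\<sigma>\<rangle>\<close>.
\<close>

section \<open>Linear extension and monomials\<close>

abbreviation (input) "lookup \<equiv> Poly_Mapping.lookup"
abbreviation (input) "keys \<equiv> Poly_Mapping.keys"
abbreviation (input) "single \<equiv> Poly_Mapping.single"

lemma poly_mapping_sum_single: "p = (\<Sum>u\<in>keys p. single u (lookup p u))"
proof (rule poly_mapping_eqI)
  fix v
  have "lookup (\<Sum>u\<in>keys p. single u (lookup p u)) v = (\<Sum>u\<in>keys p. if u = v then lookup p u else 0)"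
    by (simp add: lookup_sum lookup_single when_def)
  also have "\<dots> = lookup p v"
    by (simp add: in_keys_iff)
  finally show "lookup p v = lookup (\<Sum>u\<in>keys p. single u (lookup p u)) v" ..
qed

text \<open>A mapping is the finite sum of its terms. The coefficient of a \<open>single\<close> may
  be zero, so the first case also covers the zero mapping.\<close>

lemma poly_mapping_single_induct [case_names single add]:
  fixes p :: "'a \<Rightarrow>\<^sub>0 'b::comm_monoid_add"
  assumes single: "\<And>u c. P (single u c)" and add: "\<And>p q. P p \<Longrightarrow> P q \<Longrightarrow> P (p + q)"
  shows "P p"
proof -
  have "P (\<Sum>u\<in>A. single u (lookup p u))" if "finite A" for A
    using that
  proof induction
    case empty
    show ?case using single[of undefined 0] by simp
  next
    case (insert x A)
    then show ?case by (simp add: add single)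
  qed
  then show ?thesis
    by (subst poly_mapping_sum_single) simp
qed

text \<open>The action \<open>s\<close> is a parameter because values are taken both in polynomial
  rings and in \<open>ext_sym\<close>. Besides \<open>subst\<close>, it provides the linear maps
  that send each monomial to a chosen representative.\<close>

definition lin :: "('r \<Rightarrow> 'b \<Rightarrow> 'b) \<Rightarrow> ('u \<Rightarrow> 'b) \<Rightarrow> ('u \<Rightarrow>\<^sub>0 'r::zero) \<Rightarrow> 'b::comm_monoid_add" where
  "lin s R p = (\<Sum>u\<in>keys p. s (lookup p u) (R u))"

context module
begin

lemma lin_superset:
  fixes p :: "'u \<Rightarrow>\<^sub>0 'a"
  assumes "finite A" "keys p \<subseteq> A"
  shows "lin scale R p = (\<Sum>u\<in>A. scale (lookup p u) (R u))"
  unfolding lin_def by (rule sum.mono_neutral_left) (use assms in \<open>auto simp: in_keys_iff\<close>)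

lemma lin_add: "lin scale R (p + q) = lin scale R p + lin scale R q"
proof -
  let ?A = "keys p \<union> keys q"
  have "lin scale R (p + q) = (\<Sum>u\<in>?A. scale (lookup (p + q) u) (R u))"
    by (rule lin_superset) (simp_all add: keys_add)
  moreover have "lin scale R p = (\<Sum>u\<in>?A. scale (lookup p u) (R u))"
    by (rule lin_superset) simp_all
  moreover have "lin scale R q = (\<Sum>u\<in>?A. scale (lookup q u) (R u))"
    by (rule lin_superset) simp_all
  ultimately show ?thesis
    by (simp add: lookup_add scale_left_distrib sum.distrib)
qed

lemma lin_zero [simp]: "lin scale R 0 = 0"
  by (simp add: lin_def)

lemma lin_single [simp]: "lin scale R (single u c) = scale c (R u)"
  by (simp add: lin_def)

end

section \<open>Constants, monomials and variables in polynomial rings\<close>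

lemma const_zero [simp]: "const 0 = 0"
  by (simp add: const_def)

lemma const_one [simp]: "const 1 = 1"
  by (simp add: const_def)

lemma const_add: "const (r + s) = const r + const s"
  by (simp add: const_def single_add)

lemma const_mult: "const (r * s) = const r * const s"
  by (simp add: const_def mult_single)

abbreviation "const_scale \<equiv> \<lambda>r. (*) (const r)"

interpretation ideal: module "(*) :: 'a::comm_ring_1 \<Rightarrow> 'a \<Rightarrow> 'a"
  by (rule module_mult)

interpretation pol: module "const_scale :: 'k::comm_ring_1 \<Rightarrow> ('v, 'k) mpoly \<Rightarrow> _"
  by standard (simp_all only: const_add const_mult distrib_left distrib_right mult.assoc const_one mult_1)

text \<open>As simplification rules these instances of associativity conflict with \<open>algebra_simps\<close>.\<close>

declare ideal.scale_scale [simp del] pol.scale_scale [simp del]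

interpretation ext: module "scale :: 'r::comm_ring_1 \<Rightarrow> ('n, 'r) ext_sym \<Rightarrow> _"
  by (rule module_scale)

lemma mon_zero [simp]: "mon 0 = 1"
  by (simp add: mon_def)

lemma mon_add: "mon (u + v) = mon u * mon v"
  by (simp add: mon_def mult_single)

lemma mon_sum: "mon (\<Sum>i\<in>A. f i) = (\<Prod>i\<in>A. mon (f i))"
  by (induction A rule: infinite_finite_induct) (simp_all add: mon_add)

lemma var_power: "var v ^ n = mon (single v n)"
proof (induction n)
  case (Suc n)
  have "single v (Suc n) = single v 1 + single v n"
    by (simp flip: single_add)
  then show ?case by (simp add: Suc mon_add) (simp add: var_def)
qed simp

lemma single_eq_const_mon: "single u c = const c * mon u"
  by (simp add: const_def mon_def mult_single)

lemma lookup_mon: "lookup (mon u) v = (1 when u = v)"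
  by (simp add: mon_def lookup_single)

lemma lookup_const_mult: "lookup (const r * p) u = r * lookup p u"
  by (induction p rule: poly_mapping_single_induct)
    (simp_all add: const_def mult_single lookup_single distrib_left lookup_add when_def)

lemma lookup_mon_mult: "lookup (mon u * p) (u + v) = lookup p v"
  by (induction p rule: poly_mapping_single_induct)
    (simp_all add: mon_def mult_single lookup_single distrib_left lookup_add)

lemma lookup_mon_mult_0:
  assumes "\<And>w. v \<noteq> u + w"
  shows "lookup (mon u * p) v = 0"
proof (induction p rule: poly_mapping_single_induct)
  case (single w c)
  show ?case using assms[of w] by (auto simp: mon_def mult_single lookup_single when_def)
qed (simp add: distrib_left lookup_add)

lemma mpoly_induct [case_names const var add mult]:
  assumes const: "\<And>r. P (const r)" and var: "\<And>v. P (var v)"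
    and add: "\<And>p q. P p \<Longrightarrow> P q \<Longrightarrow> P (p + q)" and mult: "\<And>p q. P p \<Longrightarrow> P q \<Longrightarrow> P (p * q)"
  shows "P p"
proof (induction p rule: poly_mapping_single_induct)
  case (single u c)
  have "P (mon u)"
  proof (induction u rule: poly_mapping_single_induct)
    case (single v n)
    have "P (var v ^ n)"
      by (induction n) (use const[of 1] in \<open>auto intro: var mult\<close>)
    then show ?case by (simp add: var_power)
  qed (simp add: mon_add mult)
  then show ?case by (simp add: single_eq_const_mon const mult)
qed (rule add)

lemma single_split:
  assumes "lookup u b > (0 :: nat)"
  obtains v where "u = single b 1 + v"
proof
  show "u = single b 1 + (u - single b 1)"
    using assms by (intro poly_mapping_eqI) (auto simp: lookup_add lookup_minus lookup_single when_def)
qed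

text \<open>Compare coefficients in \<open>var a * y = var b * y\<close>. The coefficient of
  \<open>y\<close> at \<open>v\<close> is zero if \<open>b\<close> does not occur in
  \<open>v\<close>; otherwise it equals the one where a factor \<open>b\<close> of \<open>v\<close>
  is exchanged for \<open>a\<close>. Induction on the exponent of \<open>b\<close> avoids any
  assumption on zero divisors in the coefficient ring.\<close>

lemma var_diff_nonzerodivisor:
  assumes ab: "a \<noteq> b" and y: "(var a - var b) * y = 0"
  shows "y = 0"
proof -
  have eq: "mon (single a 1) * y = mon (single b 1) * y"
    using y by (simp add: var_def left_diff_distrib)
  have "lookup y v = 0" for v
  proof (induction "lookup v b" arbitrary: v)
    case 0
    have "lookup y v = lookup (mon (single b 1) * y) (single a 1 + v)"
      by (simp only: lookup_mon_mult flip: eq)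
    also have "\<dots> = 0"
    proof (rule lookup_mon_mult_0)
      fix w
      have "lookup (single a 1 + v) b \<noteq> lookup (single b 1 + w) b"
        using 0 ab by (simp add: lookup_add lookup_single)
      then show "single a 1 + v \<noteq> single b 1 + w" by auto
    qed
    finally show ?case .
  next
    case (Suc n)
    then obtain w where w: "v = single b 1 + w"
      using single_split[of v b] by auto
    have "lookup y v = lookup (mon (single b 1) * y) (single a 1 + v)"
      by (simp only: lookup_mon_mult flip: eq)
    also have "single a 1 + v = single b 1 + (single a 1 + w)"
      by (simp add: w ac_simps)
    also have "lookup (mon (single b 1) * y) \<dots> = lookup y (single a 1 + w)"
      by (rule lookup_mon_mult)
    also have "\<dots> = 0"
      using Suc ab by (intro Suc.hyps(1)) (simp add: w lookup_add lookup_single)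
    finally show ?case .
  qed
  then show ?thesis by (intro poly_mapping_eqI) simp
qed

section \<open>Renaming of variables\<close>

text \<open>A sum over the variables, so that exponents add up when \<open>\<phi>\<close> identifies
  variables, as depolarization does.\<close>

definition rename_exp :: "('v::finite \<Rightarrow> 'w) \<Rightarrow> ('v \<Rightarrow>\<^sub>0 nat) \<Rightarrow> ('w \<Rightarrow>\<^sub>0 nat)" where
  "rename_exp \<phi> u = (\<Sum>v\<in>UNIV. single (\<phi> v) (lookup u v))"

definition rename :: "('v::finite \<Rightarrow> 'w) \<Rightarrow> ('v, 'k) mpoly \<Rightarrow> ('w, 'k::comm_ring_1) mpoly" where
  "rename \<phi> = subst (\<lambda>v. var (\<phi> v))"

lemma rename_exp_zero [simp]: "rename_exp \<phi> 0 = 0"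
  by (simp add: rename_exp_def)

lemma rename_exp_add: "rename_exp \<phi> (u + v) = rename_exp \<phi> u + rename_exp \<phi> v"
  by (simp add: rename_exp_def lookup_add single_add sum.distrib)

lemma rename_exp_sum: "rename_exp \<phi> (\<Sum>i\<in>A. f i) = (\<Sum>i\<in>A. rename_exp \<phi> (f i))"
  by (induction A rule: infinite_finite_induct) (simp_all add: rename_exp_add)

lemma rename_exp_single [simp]: "rename_exp \<phi> (single v n) = single (\<phi> v) n"
proof -
  have "rename_exp \<phi> (single v n) = (\<Sum>w\<in>UNIV. if v = w then single (\<phi> v) n else 0)"
    unfolding rename_exp_def by (rule sum.cong) (auto simp: lookup_single when_def)
  then show ?thesis by simp
qed

lemma subst_eq_lin: "subst \<phi> = lin const_scale (\<lambda>u. \<Prod>v\<in>keys u. \<phi> v ^ lookup u v)"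
  by (rule ext) (simp add: subst_def lin_def)

lemma rename_add [simp]: "rename \<phi> (p + q) = rename \<phi> p + rename \<phi> q"
  by (simp add: rename_def subst_eq_lin pol.lin_add)

lemma rename_single:
  fixes c :: "'k::comm_ring_1" and \<phi> :: "'v::finite \<Rightarrow> 'w"
  shows "rename \<phi> (single u c) = single (rename_exp \<phi> u) c"
proof -
  have "rename_exp \<phi> u = (\<Sum>v\<in>keys u. single (\<phi> v) (lookup u v))"
    unfolding rename_exp_def by (rule sum.mono_neutral_right) (auto simp: in_keys_iff)
  then have "(\<Prod>v\<in>keys u. var (\<phi> v) ^ lookup u v) = (mon (rename_exp \<phi> u) :: ('w, 'k) mpoly)"
    by (simp add: var_power mon_sum)
  then show ?thesis
    unfolding rename_def subst_eq_lin pol.lin_single by (simp add: single_eq_const_mon)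
qed

lemma rename_const [simp]: "rename \<phi> (const r) = const r"
  by (simp add: const_def rename_single)

lemma rename_zero [simp]: "rename \<phi> 0 = 0"
  using rename_const[of \<phi> 0] by simp

lemma rename_mon: "rename \<phi> (mon u) = mon (rename_exp \<phi> u)"
  by (simp add: mon_def rename_single)

lemma rename_var [simp]: "rename \<phi> (var v) = var (\<phi> v)"
  by (simp add: var_def rename_mon)

lemma rename_diff [simp]: "rename \<phi> (p - q) = rename \<phi> p - rename \<phi> q"
proof -
  have "rename \<phi> (p - q) + rename \<phi> q = rename \<phi> p"
    by (simp flip: rename_add)
  then show ?thesis by (simp add: algebra_simps)
qed

lemma rename_mult [simp]: "rename \<phi> (p * q) = rename \<phi> p * rename \<phi> q"
proof (induction p rule: poly_mapping_single_induct)
  case (single u c)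
  show ?case
    by (induction q rule: poly_mapping_single_induct)
      (simp_all add: mult_single rename_single rename_exp_add distrib_left)
qed (simp add: distrib_right)

lemma rename_rename: "rename \<phi> (rename \<psi> p) = rename (\<lambda>v. \<phi> (\<psi> v)) p"
  by (induction p rule: mpoly_induct) simp_all

lemma depolarize_eq_rename: "depolarize = rename fst"
  by (simp add: depolarize_def rename_def case_prod_unfold)

section \<open>Regular sequences modulo an ideal\<close>

definition set_prod :: "'a::comm_ring_1 set \<Rightarrow> 'a set \<Rightarrow> 'a set" where
  "set_prod S G = {s * g | s g. s \<in> S \<and> g \<in> G}"

lemma ideal_gen_mult:
  assumes "s \<in> S" "j \<in> ideal_gen G"
  shows "s * j \<in> ideal_gen (set_prod S G)"
  using assms(2) unfolding ideal_gen_def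
proof (induction rule: ideal.span_induct_alt)
  case base
  show ?case by (simp add: ideal.span_zero)
next
  case (step c g j)
  have "c * (s * g) \<in> ideal.span (set_prod S G)"
    using assms(1) step(1) by (intro ideal.span_scale ideal.span_base) (auto simp: set_prod_def)
  moreover have "s * (c * g + j) = c * (s * g) + s * j"
    by (simp add: algebra_simps)
  ultimately show ?case
    using step(2) by (simp only: ideal.span_add)
qed

text \<open>Splits the product ideal as \<open>r\<close> times the ideal of \<open>G\<close> plus
  the product ideal for \<open>L\<close>: all multiples of generators with first factor
  \<open>r\<close> are collected into the single term \<open>r * j\<close>.\<close>

lemma ideal_gen_set_prod_insert:
  assumes "p \<in> ideal_gen (set_prod (insert r L) G)"
  obtains j where "j \<in> ideal_gen G" "p - r * j \<in> ideal_gen (set_prod L G)"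
proof -
  have "\<exists>j \<in> ideal.span G. p - r * j \<in> ideal.span (set_prod L G)"
    using assms unfolding ideal_gen_def
  proof (induction rule: ideal.span_induct_alt)
    case base
    show ?case by (rule bexI[of _ 0]) (simp_all add: ideal.span_zero)
  next
    case (step c x q)
    then obtain j where j: "j \<in> ideal.span G" "q - r * j \<in> ideal.span (set_prod L G)"
      by auto
    from step(1) obtain s g where x: "x = s * g" "s \<in> insert r L" "g \<in> G"
      by (auto simp: set_prod_def)
    show ?case
    proof (cases "s = r")
      case True
      have "c * g + j \<in> ideal.span G"
        by (intro ideal.span_add ideal.span_scale ideal.span_base x j)
      moreover have "c * x + q - r * (c * g + j) = q - r * j"
        using True by (simp add: x(1) algebra_simps)
      ultimately show ?thesis using j(2) by metis
    next
      case False
      then have "x \<in> set_prod L G" using x by (auto simp: set_prod_def)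
      then have "c * x + (q - r * j) \<in> ideal.span (set_prod L G)"
        by (intro ideal.span_add ideal.span_scale ideal.span_base j)
      then show ?thesis using j(1) by (metis add_diff_eq)
    qed
  qed
  then show thesis using that by (auto simp: ideal_gen_def)
qed

lemma set_prod_mono: "S \<subseteq> S' \<Longrightarrow> G \<subseteq> G' \<Longrightarrow> set_prod S G \<subseteq> set_prod S' G'"
  by (auto simp: set_prod_def)

lemma ideal_gen_set_prod_subset: "ideal_gen (set_prod S G) \<subseteq> ideal_gen S"
proof -
  have "g * s \<in> ideal.span S" if "s \<in> S" for g s
    using that by (intro ideal.span_scale ideal.span_base)
  then show ?thesis
    unfolding ideal_gen_def
    by (intro ideal.span_minimal) (auto simp: set_prod_def mult.commute)
qed

lemma ideal_gen_Un_ideal_gen: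
  "p \<in> ideal_gen (ideal_gen G \<union> S) \<longleftrightarrow> (\<exists>j\<in>ideal_gen G. p - j \<in> ideal_gen S)"
proof
  assume "p \<in> ideal_gen (ideal_gen G \<union> S)"
  then obtain x y where "p = x + y" "x \<in> ideal.span (ideal.span G)" "y \<in> ideal.span S"
    unfolding ideal_gen_def ideal.span_Un by auto
  then show "\<exists>j\<in>ideal_gen G. p - j \<in> ideal_gen S"
    by (intro bexI[of _ x]) (auto simp: ideal_gen_def ideal.span_span)
next
  assume "\<exists>j\<in>ideal_gen G. p - j \<in> ideal_gen S"
  then obtain j where j: "j \<in> ideal.span G" "p - j \<in> ideal.span S"
    by (auto simp: ideal_gen_def)
  then have "j + (p - j) \<in> ideal.span (ideal.span G \<union> S)"
    by (intro ideal.span_add) (auto intro: ideal.span_base subsetD[OF ideal.span_mono, rotated])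
  then show "p \<in> ideal_gen (ideal_gen G \<union> S)"
    by (simp add: ideal_gen_def)
qed

text \<open>The conclusion is the vanishing of \<open>Tor\<^sub>1\<close> of the quotients by the ideals of \<open>G\<close> and \<open>rs\<close>.\<close>

lemma inter_subset_of_regular:
  assumes "\<And>k y. k < length rs \<Longrightarrow> rs ! k * y \<in> ideal_gen (ideal_gen G \<union> set (take k rs)) \<Longrightarrow>
      y \<in> ideal_gen (ideal_gen G \<union> set (take k rs))"
    and "p \<in> ideal_gen G" "p \<in> ideal_gen (set rs)"
  shows "p \<in> ideal_gen (set_prod (set rs) G)"
  using assms
proof (induction rs arbitrary: p rule: rev_induct)
  case Nil
  then show ?case by (simp add: ideal_gen_def ideal.span_zero)
next
  case (snoc r rs)
  \<comment> \<open>\<open>k\<close> is the coefficient of the last entry \<open>r\<close> in an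
    expression of \<open>p\<close> by the sequence. Regularity at \<open>r\<close> then places
    \<open>k\<close> in the ideal of \<open>G\<close> modulo the earlier entries.\<close>
  obtain k where k: "p - k * r \<in> ideal_gen (set rs)"
    using snoc.prems(3) by (auto simp: ideal_gen_def ideal.span_breakdown_eq)
  have "r * k \<in> ideal_gen (ideal_gen G \<union> set rs)"
    unfolding ideal_gen_Un_ideal_gen
  proof (rule bexI[of _ p])
    show "r * k - p \<in> ideal_gen (set rs)"
      using k ideal.span_neg[of "p - k * r" "set rs"] by (simp add: ideal_gen_def mult.commute)
  qed (rule snoc.prems)
  then have "k \<in> ideal_gen (ideal_gen G \<union> set rs)"
    using snoc.prems(1)[of "length rs" k] by simp
  then obtain j where j: "j \<in> ideal_gen G" "k - j \<in> ideal_gen (set rs)"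
    unfolding ideal_gen_Un_ideal_gen by auto
  \<comment> \<open>Subtracting \<open>r * j\<close>, which already lies in the product ideal,
    leaves an element of both ideals for the shorter sequence.\<close>
  have "p - r * j \<in> ideal_gen (set_prod (set rs) G)"
  proof (rule snoc.IH)
    fix i y
    assume "i < length rs" "rs ! i * y \<in> ideal_gen (ideal_gen G \<union> set (take i rs))"
    then show "y \<in> ideal_gen (ideal_gen G \<union> set (take i rs))"
      using snoc.prems(1)[of i y] by (simp add: nth_append)
  next
    show "p - r * j \<in> ideal_gen G"
      using snoc.prems(2) j(1) by (simp add: ideal_gen_def ideal.span_diff ideal.span_scale)
    have "(p - k * r) + r * (k - j) \<in> ideal_gen (set rs)"
      using k j(2) unfolding ideal_gen_def by (intro ideal.span_add ideal.span_scale)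
    then show "p - r * j \<in> ideal_gen (set rs)"
      by (simp add: algebra_simps)
  qed
  moreover have "ideal_gen (set_prod (set rs) G) \<subseteq> ideal_gen (set_prod (set (rs @ [r])) G)"
    unfolding ideal_gen_def by (intro ideal.span_mono set_prod_mono) auto
  ultimately have "(p - r * j) + r * j \<in> ideal_gen (set_prod (set (rs @ [r])) G)"
    using ideal_gen_mult[of r "set (rs @ [r])" j G] j(1)
    unfolding ideal_gen_def by (intro ideal.span_add) auto
  then show ?case by simp
qed

text \<open>Write \<open>r * y = j + l\<close> with \<open>j\<close> in the ideal of
  \<open>G\<close> and \<open>l\<close> in that of \<open>L\<close>. Then \<open>j\<close> lies in
  the intersection, hence equals \<open>r * q\<close> modulo the ideal of \<open>L\<close> with
  \<open>q\<close> in the ideal of \<open>G\<close>. Cancelling \<open>r\<close> in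
  \<open>r * (y - q)\<close> modulo \<open>L\<close> gives the claim.\<close>

lemma regular_of_inter_subset:
  assumes inter: "\<And>p. p \<in> ideal_gen G \<Longrightarrow> p \<in> ideal_gen (insert r L) \<Longrightarrow> p \<in> ideal_gen (set_prod (insert r L) G)"
    and nzd: "\<And>y. r * y \<in> ideal_gen L \<Longrightarrow> y \<in> ideal_gen L"
    and y: "r * y \<in> ideal_gen (ideal_gen G \<union> L)"
  shows "y \<in> ideal_gen (ideal_gen G \<union> L)"
proof -
  from y obtain j where j: "j \<in> ideal_gen G" "r * y - j \<in> ideal_gen L"
    unfolding ideal_gen_Un_ideal_gen by auto
  have "j - y * r \<in> ideal_gen L"
    using j(2) ideal.span_neg[of "r * y - j" L] by (simp add: ideal_gen_def mult.commute)
  then have "j \<in> ideal_gen (insert r L)"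
    by (auto simp: ideal_gen_def ideal.span_breakdown_eq)
  then obtain q where q: "q \<in> ideal_gen G" "j - r * q \<in> ideal_gen (set_prod L G)"
    using inter j(1) ideal_gen_set_prod_insert by metis
  have "(r * y - j) + (j - r * q) \<in> ideal_gen L"
    using j(2) q(2) ideal_gen_set_prod_subset unfolding ideal_gen_def by (intro ideal.span_add) blast+
  then have "r * (y - q) \<in> ideal_gen L" by (simp add: algebra_simps)
  then show ?thesis
    using nzd q(1) unfolding ideal_gen_Un_ideal_gen by auto
qed

section \<open>Homogeneous components\<close>

lemma mdeg_UNIV: "mdeg (u :: 'v::finite \<Rightarrow>\<^sub>0 nat) = (\<Sum>v\<in>UNIV. lookup u v)"
  unfolding mdeg_def by (rule sum.mono_neutral_left) (auto simp: in_keys_iff)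

lemma mdeg_add: "mdeg (u + v :: 'v::finite \<Rightarrow>\<^sub>0 nat) = mdeg u + mdeg v"
  by (simp add: mdeg_UNIV lookup_add sum.distrib)

lemma mdeg_single [simp]: "mdeg (single v n) = n"
  by (simp add: mdeg_def)

lemma mdeg_sum: "mdeg (\<Sum>i\<in>A. f i :: 'v::finite \<Rightarrow>\<^sub>0 nat) = (\<Sum>i\<in>A. mdeg (f i))"
  by (induction A rule: infinite_finite_induct) (simp_all add: mdeg_add, simp_all add: mdeg_def)

definition homog_part :: "nat \<Rightarrow> ('v, 'k::comm_ring_1) mpoly \<Rightarrow> ('v, 'k) mpoly" where
  "homog_part D p = Poly_Mapping.mapp (\<lambda>u c. c when mdeg u = D) p"

lemma lookup_homog_part: "lookup (homog_part D p) u = (lookup p u when mdeg u = D)"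
  by (simp add: homog_part_def lookup_mapp when_def in_keys_iff)

lemma homog_part_add: "homog_part D (p + q) = homog_part D p + homog_part D q"
  by (rule poly_mapping_eqI) (simp add: lookup_homog_part lookup_add when_def)

lemma homog_part_zero [simp]: "homog_part D 0 = 0"
  by (rule poly_mapping_eqI) (simp add: lookup_homog_part)

lemma homog_part_diff: "homog_part D (p - q) = homog_part D p - homog_part D q"
  by (rule poly_mapping_eqI) (simp add: lookup_homog_part lookup_minus when_def)

lemma homog_part_single: "homog_part D (single u c) = (single u c when mdeg u = D)"
  by (rule poly_mapping_eqI) (auto simp: lookup_homog_part lookup_single when_def)

lemma homog_part_mon_mult:
  fixes u :: "'v::finite \<Rightarrow>\<^sub>0 nat"
  shows "homog_part D (mon u * p) = (if mdeg u \<le> D then mon u * homog_part (D - mdeg u) p else 0)"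
proof (induction p rule: poly_mapping_single_induct)
  case (single v c)
  show ?case by (auto simp: mon_def mult_single homog_part_single mdeg_add when_def)
qed (simp add: distrib_left homog_part_add)

lemma sum_homog_part: "p = (\<Sum>D\<in>mdeg ` keys p. homog_part D p)"
proof (rule poly_mapping_eqI)
  fix u
  have "lookup (\<Sum>D\<in>mdeg ` keys p. homog_part D p) u
      = (\<Sum>D\<in>mdeg ` keys p. if mdeg u = D then lookup p u else 0)"
    by (simp add: lookup_sum lookup_homog_part when_def)
  also have "\<dots> = lookup p u"
    by (auto simp: in_keys_iff)
  finally show "lookup p u = lookup (\<Sum>D\<in>mdeg ` keys p. homog_part D p) u" ..
qed

text \<open>The generators are homogeneous, so taking a component of a multiple only shifts the
  degree taken in the cofactor. The form of \<open>S\<close> covers differences of variables and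
  their products with monomials.\<close>

lemma homog_part_ideal_gen:
  fixes S :: "('v::finite, 'k::comm_ring_1) mpoly set"
  assumes S: "\<And>s. s \<in> S \<Longrightarrow> \<exists>u v. s = mon u - mon v \<and> mdeg u = mdeg v"
    and "p \<in> ideal_gen S"
  shows "homog_part D p \<in> ideal_gen S"
  using assms(2) unfolding ideal_gen_def
proof (induction rule: ideal.span_induct_alt)
  case base
  show ?case by (simp add: ideal.span_zero)
next
  case (step c s p)
  obtain u v where s: "s = mon u - mon v" "mdeg u = mdeg v"
    using S step(1) by blast
  have "homog_part D (c * s) = (if mdeg u \<le> D then homog_part (D - mdeg u) c else 0) * s"
    by (simp add: s mult.commute[of c] left_diff_distrib homog_part_diff homog_part_mon_mult)
      (simp add: algebra_simps)
  then have "homog_part D (c * s) \<in> ideal.span S"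
    using step(1) by (metis ideal.span_base ideal.span_scale)
  then show ?case using step(2) by (simp add: homog_part_add ideal.span_add)
qed

text \<open>Graded Nakayama: the intersection modulo the product ideal equals \<open>r\<close> times itself.\<close>

lemma inter_subset_descend:
  fixes G :: "('v::finite, 'k::comm_ring_1) mpoly set"
  assumes inter: "\<And>p. p \<in> ideal_gen G \<Longrightarrow> p \<in> ideal_gen (insert r L) \<Longrightarrow> p \<in> ideal_gen (set_prod (insert r L) G)"
    and nzd: "\<And>y. r * y \<in> ideal_gen L \<Longrightarrow> y \<in> ideal_gen L"
    and L: "\<And>s. s \<in> insert r L \<Longrightarrow> \<exists>a b. s = var a - var b"
    and G: "G \<subseteq> range mon"
    and p: "p \<in> ideal_gen G" "p \<in> ideal_gen L"
  shows "p \<in> ideal_gen (set_prod L G)"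
proof -
  define N where "N = ideal_gen (set_prod L G)"
  \<comment> \<open>Splitting off the generators containing \<open>r\<close> leaves
    \<open>r * q\<close>. As \<open>r * q\<close> is in the ideal of \<open>L\<close>, cancelling
    \<open>r\<close> keeps \<open>q\<close> in the same intersection, so the step can be
    repeated.\<close>
  have step: "\<exists>q. q \<in> ideal_gen G \<and> q \<in> ideal_gen L \<and> p - r * q \<in> N"
    if "p \<in> ideal_gen G" "p \<in> ideal_gen L" for p
  proof -
    have "ideal_gen L \<subseteq> ideal_gen (insert r L)"
      unfolding ideal_gen_def by (rule ideal.span_mono) auto
    then have "p \<in> ideal_gen (set_prod (insert r L) G)"
      using that by (intro inter) auto
    then obtain q where q: "q \<in> ideal_gen G" "p - r * q \<in> N"
      unfolding N_def by (rule ideal_gen_set_prod_insert)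
    then have "p - r * q \<in> ideal_gen L"
      using ideal_gen_set_prod_subset unfolding N_def by blast
    then have "p - (p - r * q) \<in> ideal_gen L"
      using that(2) unfolding ideal_gen_def by (rule ideal.span_diff[rotated])
    then show ?thesis using nzd q by auto
  qed
  obtain a b where r: "r = mon (single a 1) - mon (single b 1)"
    using L[of r] by (auto simp: var_def)
  have N: "homog_part D q \<in> N" if "q \<in> N" for D q
    unfolding N_def
  proof (rule homog_part_ideal_gen)
    fix s assume "s \<in> set_prod L G"
    then obtain a b u where "s = (var a - var b) * mon u"
      using L G by (fastforce simp: set_prod_def)
    then have "s = mon (single a 1 + u) - mon (single b 1 + u)"
      by (simp add: var_def mon_add left_diff_distrib)
    then show "\<exists>u v. s = mon u - mon v \<and> mdeg u = mdeg v"
      by (metis mdeg_add mdeg_single)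
  qed (use that in \<open>simp add: N_def\<close>)
  \<comment> \<open>Since \<open>r\<close> is homogeneous of degree one, the component of
    \<open>r * q\<close> in degree \<open>Suc D\<close> is \<open>r\<close> times the component of
    \<open>q\<close> in degree \<open>D\<close>, and \<open>r * q\<close> has no component in degree
    zero. Induction on the degree thus replaces infinite iteration.\<close>
  have part: "homog_part D p \<in> N" if "p \<in> ideal_gen G" "p \<in> ideal_gen L" for D p
    using that
  proof (induction D arbitrary: p)
    case (0 p)
    then obtain q where "p - r * q \<in> N" using step by blast
    then have "homog_part 0 (p - r * q) \<in> N" by (rule N)
    then show ?case
      by (simp add: homog_part_diff r left_diff_distrib homog_part_mon_mult)
  next
    case (Suc D p)
    then obtain q where q: "q \<in> ideal_gen G" "q \<in> ideal_gen L" "p - r * q \<in> N"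
      using step by blast
    have "r * homog_part D q \<in> N"
      using Suc.IH[OF q(1,2)] unfolding N_def ideal_gen_def by (rule ideal.span_scale)
    moreover have "homog_part (Suc D) (p - r * q) \<in> N" by (rule N) (rule q)
    ultimately have "homog_part (Suc D) (p - r * q) + r * homog_part D q \<in> N"
      unfolding N_def ideal_gen_def by (intro ideal.span_add)
    moreover have "homog_part (Suc D) (p - r * q) + r * homog_part D q = homog_part (Suc D) p"
      by (simp add: homog_part_diff r left_diff_distrib homog_part_mon_mult)
    ultimately show ?case by simp
  qed
  have "(\<Sum>D\<in>mdeg ` keys p. homog_part D p) \<in> N"
    using part p unfolding N_def ideal_gen_def by (intro ideal.span_sum) auto
  then show ?thesis by (simp add: N_def flip: sum_homog_part)
qed

section \<open>Ideals generated by differences of variables\<close>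

text \<open>\<open>\<psi>\<close> is meant to be idempotent, choosing a representative in each class
  of variables; \<open>base_var\<close> is the instance that yields \<open>sigma\<close>.\<close>

definition var_diff :: "('v \<Rightarrow> 'v) \<Rightarrow> 'v \<Rightarrow> ('v, 'k::comm_ring_1) mpoly" where
  "var_diff \<psi> v = var (\<psi> v) - var v"

text \<open>Clear for variables; for products it follows from
  \<open>p * q - p' * q' = p * (q - q') + q' * (p - p')\<close>.\<close>

lemma diff_rename_in_ideal:
  fixes p :: "('v::finite, 'k::comm_ring_1) mpoly"
  shows "p - rename (\<lambda>v. if v \<in> P then \<psi> v else v) p \<in> ideal_gen (var_diff \<psi> ` P)"
    (is "p - rename ?\<phi> p \<in> _")
  unfolding ideal_gen_def
proof (induction p rule: mpoly_induct)
  case (const r)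
  show ?case by (simp add: ideal.span_zero)
next
  case (var v)
  show ?case
  proof (cases "v \<in> P")
    case True
    then have "- var_diff \<psi> v \<in> ideal.span (var_diff \<psi> ` P :: ('v, 'k) mpoly set)"
      by (intro ideal.span_neg ideal.span_base) simp
    then show ?thesis using True by (simp add: var_diff_def)
  qed (simp add: ideal.span_zero)
next
  case (add p q)
  then have "(p - rename ?\<phi> p) + (q - rename ?\<phi> q) \<in> ideal.span (var_diff \<psi> ` P)"
    by (rule ideal.span_add)
  then show ?case by (simp add: algebra_simps)
next
  case (mult p q)
  then have "p * (q - rename ?\<phi> q) + rename ?\<phi> q * (p - rename ?\<phi> p) \<in> ideal.span (var_diff \<psi> ` P)"
    by (intro ideal.span_add ideal.span_scale)
  then show ?case by (simp add: algebra_simps)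
qed

text \<open>The ideal is the kernel of a renaming, which turns membership into an equation in a
  polynomial ring. Idempotence makes the renaming kill each generator even when
  \<open>\<psi> v\<close> itself lies in \<open>P\<close>.\<close>

lemma ideal_var_diff_iff:
  fixes p :: "('v::finite, 'k::comm_ring_1) mpoly"
  assumes \<psi>: "\<And>v. \<psi> (\<psi> v) = \<psi> v"
  shows "p \<in> ideal_gen (var_diff \<psi> ` P) \<longleftrightarrow> rename (\<lambda>v. if v \<in> P then \<psi> v else v) p = 0"
    (is "_ \<longleftrightarrow> rename ?\<phi> p = 0")
proof
  assume "rename ?\<phi> p = 0"
  then show "p \<in> ideal_gen (var_diff \<psi> ` P)"
    using diff_rename_in_ideal[of p P \<psi>] by simp
next
  assume "p \<in> ideal_gen (var_diff \<psi> ` P)"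
  then show "rename ?\<phi> p = 0"
    unfolding ideal_gen_def
    by (induction rule: ideal.span_induct_alt) (auto simp: var_diff_def \<psi>)
qed

text \<open>The renaming with kernel the ideal of \<open>P\<close> fixes both \<open>w\<close> and
  \<open>\<psi> w\<close>, so the new generator remains a difference of two distinct
  variables.\<close>

lemma var_diff_nonzerodivisor_mod:
  fixes y :: "('v::finite, 'k::comm_ring_1) mpoly"
  assumes \<psi>: "\<And>v. \<psi> (\<psi> v) = \<psi> v" and w: "w \<notin> P" "\<psi> w \<noteq> w"
    and y: "var_diff \<psi> w * y \<in> ideal_gen (var_diff \<psi> ` P)"
  shows "y \<in> ideal_gen (var_diff \<psi> ` P)"
proof -
  have "rename (\<lambda>v. if v \<in> P then \<psi> v else v) (var_diff \<psi> w * y) = 0"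
    using y by (simp add: ideal_var_diff_iff[OF \<psi>])
  then have "(var (\<psi> w) - var w) * rename (\<lambda>v. if v \<in> P then \<psi> v else v) y = 0"
    using w(1) by (simp add: var_diff_def \<psi> del: mult_eq_0_iff split: if_splits)
  then show ?thesis
    using var_diff_nonzerodivisor[OF w(2)] by (simp add: ideal_var_diff_iff[OF \<psi>])
qed

text \<open>From right to left, the condition is given for the whole sequence but regularity at an
  entry requires it for the prefix ending there.\<close>

lemma regular_iff_inter_subset:
  fixes G :: "('v::finite, 'k::comm_ring_1) mpoly set"
  assumes \<psi>: "\<And>v. \<psi> (\<psi> v) = \<psi> v" and vs: "distinct vs" "\<And>v. v \<in> set vs \<Longrightarrow> \<psi> v \<noteq> v"
    and G: "G \<subseteq> range mon" and rs: "rs = map (var_diff \<psi>) vs"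
  shows "(\<forall>k < length rs. \<forall>y. rs ! k * y \<in> ideal_gen (ideal_gen G \<union> set (take k rs))
        \<longrightarrow> y \<in> ideal_gen (ideal_gen G \<union> set (take k rs))) \<longleftrightarrow>
      ideal_gen G \<inter> ideal_gen (set rs) \<subseteq> ideal_gen (set_prod (set rs) G)"
    (is "?reg \<longleftrightarrow> ?inter")
proof
  assume ?reg
  then show ?inter using inter_subset_of_regular[of rs G] by blast
next
  assume inter: ?inter
  have nzd: "y \<in> ideal_gen (set (take k rs))"
    if "k < length rs" "rs ! k * y \<in> ideal_gen (set (take k rs))" for k y
  proof -
    have "vs ! k \<notin> set (take k vs)"
      using vs(1) that(1) by (auto simp: rs in_set_conv_nth nth_eq_iff_index_eq)
    moreover have "\<psi> (vs ! k) \<noteq> vs ! k"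
      using vs(2) that(1) by (simp add: rs)
    ultimately show ?thesis
      using that var_diff_nonzerodivisor_mod[OF \<psi>, of "vs ! k" "set (take k vs)" y]
      by (simp add: rs take_map)
  qed
  have take_Suc: "set (take (Suc k) rs) = insert (rs ! k) (set (take k rs))" if "k < length rs" for k
    using that by (simp add: take_Suc_conv_app_nth)
  \<comment> \<open>Downward induction on the length of the prefix, starting from the whole sequence
    and removing its last entry each time.\<close>
  have inter_take: "p \<in> ideal_gen (set_prod (set (take k rs)) G)"
    if "k \<le> length rs" "p \<in> ideal_gen G" "p \<in> ideal_gen (set (take k rs))" for k p
    using that
  proof (induction k arbitrary: p rule: inc_induct)
    case base
    then show ?case using inter by auto
  next
    case (step k)
    show ?case
    proof (rule inter_subset_descend[of G "rs ! k"])
      show "\<exists>a b. s = var a - var b" if "s \<in> insert (rs ! k) (set (take k rs))" for s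
      proof -
        have "s \<in> set rs" using that step(2) by (auto dest: in_set_takeD)
        then show ?thesis by (auto simp: rs var_diff_def)
      qed
      show "p \<in> ideal_gen (set_prod (insert (rs ! k) (set (take k rs))) G)"
        if "p \<in> ideal_gen G" "p \<in> ideal_gen (insert (rs ! k) (set (take k rs)))" for p
        using step.IH[of p] that take_Suc[OF step(2)] by simp
    qed (use nzd step G in auto)
  qed
  show ?reg
  proof (intro allI impI)
    fix k y
    assume k: "k < length rs" and y: "rs ! k * y \<in> ideal_gen (ideal_gen G \<union> set (take k rs))"
    show "y \<in> ideal_gen (ideal_gen G \<union> set (take k rs))"
    proof (rule regular_of_inter_subset[OF _ _ y])
      \<comment> \<open>The prefix of length \<open>Suc k\<close> is the one that includes the entry
        \<open>rs ! k\<close> under consideration.\<close>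
      show "p \<in> ideal_gen (set_prod (insert (rs ! k) (set (take k rs))) G)"
        if "p \<in> ideal_gen G" "p \<in> ideal_gen (insert (rs ! k) (set (take k rs)))" for p
        using inter_take[of "Suc k" p] that take_Suc[OF k] k by simp
    qed (use nzd k in auto)
  qed
qed

text \<open>Depolarization realized inside the larger polynomial ring: as an idempotent renaming it
  fits the preceding lemmas.\<close>

definition base_var :: "'n \<times> 'd::{finite,linorder} \<Rightarrow> 'n \<times> 'd" where
  "base_var v = (fst v, Min UNIV)"

lemma base_var_simps [simp]: "base_var (base_var v) = base_var v" "base_var (i, j) = (i, Min UNIV)"
  "fst (base_var v) = fst v"
  by (simp_all add: base_var_def)

definition nonbase_vars :: "('n::{finite,linorder} \<times> 'd::{finite,linorder}) list" where
  "nonbase_vars = List.product (sorted_list_of_set UNIV) (sorted_list_of_set (UNIV - {Min UNIV}))"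

lemma sigma_eq: "sigma = map (var_diff base_var) nonbase_vars"
  by (simp add: sigma_def nonbase_vars_def product_concat_map map_concat o_def var_diff_def)

lemma distinct_nonbase_vars: "distinct nonbase_vars"
  by (simp add: nonbase_vars_def distinct_product)

lemma set_nonbase_vars: "set nonbase_vars = {v. base_var v \<noteq> v}"
  by (auto simp: nonbase_vars_def)

lemma ideal_sigma_iff:
  fixes p :: "('n::{finite,linorder} \<times> 'd::{finite,linorder}, 'k::comm_ring_1) mpoly"
  shows "p \<in> ideal_gen (set sigma) \<longleftrightarrow> rename base_var p = 0"
proof -
  have "set (sigma :: ('n \<times> 'd, 'k) mpoly list) = var_diff base_var ` {v. base_var v \<noteq> v}"
    by (simp add: sigma_eq set_nonbase_vars)
  moreover have "(\<lambda>v. if v \<in> {v. base_var v \<noteq> v} then base_var v else v) = (base_var :: 'n \<times> 'd \<Rightarrow> _)"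
    by auto
  ultimately show ?thesis
    using ideal_var_diff_iff[of base_var p "{v. base_var v \<noteq> v}"] by simp
qed

text \<open>Each of the two renamings factors through the other, so they have the same
  kernel.\<close>

lemma rename_base_var_eq_zero:
  fixes p :: "('n::finite \<times> 'd::{finite,linorder}, 'k::comm_ring_1) mpoly"
  shows "rename base_var p = 0 \<longleftrightarrow> depolarize p = 0"
proof -
  have "rename base_var p = rename (\<lambda>i. (i, Min UNIV)) (depolarize p)"
    by (simp add: depolarize_eq_rename rename_rename base_var_def[abs_def])
  moreover have "depolarize p = rename fst (rename base_var p)"
    by (simp add: depolarize_eq_rename rename_rename base_var_def[abs_def])
  ultimately show ?thesis by (metis rename_zero)
qed

lemma ideal_sigma_iff_depolarize: "p \<in> ideal_gen (set sigma) \<longleftrightarrow> depolarize p = 0"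
  by (simp only: ideal_sigma_iff rename_base_var_eq_zero)

text \<open>Exponent vectors add up to zero only if both are zero. Multiplicativity of the constant
  coefficient serves to show that an ideal is proper.\<close>

lemma lookup_mult_at_0:
  fixes p q :: "('v, 'k::comm_ring_1) mpoly"
  shows "lookup (p * q) 0 = lookup p 0 * lookup q 0"
proof (induction p rule: poly_mapping_single_induct)
  case (single u c)
  have "u + v = 0 \<longleftrightarrow> u = 0 \<and> v = 0" for u v :: "'v \<Rightarrow>\<^sub>0 nat"
    by (auto simp: poly_mapping_eq_iff lookup_add fun_eq_iff)
  then show ?case
    by (induction q rule: poly_mapping_single_induct)
      (auto simp: mult_single lookup_single when_def distrib_left lookup_add)
qed (simp add: distrib_right lookup_add)

lemma regular_sigma_iff:
  fixes G :: "('n::{finite,linorder} \<times> 'd::{finite,linorder}, 'k::comm_ring_1) mpoly set"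
  assumes "G \<subseteq> range mon" "1 \<notin> G"
  shows "regular_on_quotient (ideal_gen G) sigma \<longleftrightarrow>
    (\<forall>p\<in>ideal_gen G. depolarize p = 0 \<longrightarrow> p \<in> ideal_gen (set_prod (set sigma) G))"
proof -
  \<comment> \<open>For properness of the quotient: the generators of both kinds have constant
    coefficient zero, hence so has the whole ideal, which therefore misses \<open>1\<close>.\<close>
  have const_coeff_0: "lookup p 0 = 0"
    if "\<And>s. s \<in> S \<Longrightarrow> lookup s 0 = 0" "p \<in> ideal_gen S" for S and p :: "('n \<times> 'd, 'k) mpoly"
    using that(2) unfolding ideal_gen_def
    by (induction rule: ideal.span_induct_alt) (simp_all add: that(1) lookup_add lookup_mult_at_0)
  have "lookup p 0 = 0" if "p \<in> ideal_gen (ideal_gen G \<union> set sigma)" for p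
  proof (rule const_coeff_0[OF _ that])
    fix s assume "s \<in> ideal_gen G \<union> set sigma"
    then show "lookup s 0 = 0"
    proof
      assume "s \<in> ideal_gen G"
      then show ?thesis
      proof (rule const_coeff_0[rotated])
        fix g assume "g \<in> G"
        with assms obtain u where "g = mon u" "u \<noteq> 0" by force
        then show "lookup g 0 = 0" by (simp add: lookup_mon)
      qed
    next
      have "single v (1 :: nat) \<noteq> 0" for v :: "'n \<times> 'd"
        by (metis lookup_single_eq lookup_zero one_neq_zero)
      moreover assume "s \<in> set sigma"
      ultimately show ?thesis
        by (auto simp: sigma_eq var_diff_def var_def lookup_minus lookup_mon when_def)
    qed
  qed
  from this[of 1] have "ideal_gen (ideal_gen G \<union> set sigma) \<noteq> UNIV"
    by auto
  then show ?thesis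
    unfolding regular_on_quotient_def
    using regular_iff_inter_subset[OF _ distinct_nonbase_vars _ assms(1) sigma_eq]
    by (auto simp: set_nonbase_vars ideal_sigma_iff_depolarize)
qed

section \<open>Spanning trees\<close>

lemma graph_connected_mono:
  assumes "graph_connected V E" "E \<subseteq> E'"
  shows "graph_connected V E'"
proof -
  have "{(x, y). {x, y} \<in> E}\<^sup>* \<subseteq> {(x, y). {x, y} \<in> E'}\<^sup>*"
    using assms(2) by (intro rtrancl_mono) auto
  then show ?thesis using assms(1) unfolding graph_connected_def by blast
qed

text \<open>The rest of the cycle is a detour around a deleted edge, here the one closing the
  list.\<close>

lemma graph_connected_delete_cycle_edge:
  assumes "graph_connected V E" "graph_cycle E p"
  shows "\<exists>e\<in>E. graph_connected V (E - {e})"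
proof -
  define m where "m = length p - 1"
  have p: "length p \<ge> 3" "distinct p" and E: "\<And>t. t < length p \<Longrightarrow> {p ! t, p ! (Suc t mod length p)} \<in> E"
    using assms(2) by (auto simp: graph_cycle_def)
  have "p \<noteq> []" using p(1) by auto
  have m: "m < length p" "Suc m = length p" "m \<ge> 2" using p(1) by (auto simp: m_def)
  define e where "e = {p ! m, p ! 0}"
  have e: "e \<in> E" using E[OF m(1)] m by (simp add: e_def)
  define S where "S = {(x, y). {x, y} \<in> E - {e}}"
  have "sym S" by (auto simp: S_def sym_def insert_commute)
  then have sym: "sym (S\<^sup>*)" by (rule sym_rtrancl)
  have "(p ! 0, p ! t) \<in> S\<^sup>*" if "t \<le> m" for t
    using that
  proof (induction t)
    case (Suc t)
    \<comment> \<open>By distinctness and \<open>m \<ge> 2\<close>, no pair of neighbours along the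
      list consists of its last and first vertex.\<close>
    have "{p ! t, p ! Suc t} \<noteq> e"
      using Suc.prems m \<open>p \<noteq> []\<close> nth_eq_iff_index_eq[OF p(2), of t m] nth_eq_iff_index_eq[OF p(2), of t 0]
        nth_eq_iff_index_eq[OF p(2), of "Suc t" m]
      by (auto simp: e_def doubleton_eq_iff)
    moreover have "Suc t < length p" using Suc.prems m by linarith
    then have "{p ! t, p ! Suc t} \<in> E" using E[of t] by simp
    ultimately have "(p ! t, p ! Suc t) \<in> S" by (simp add: S_def)
    then show ?case using Suc by (auto intro: rtrancl_into_rtrancl)
  qed simp
  from this[of m] have "(p ! 0, p ! m) \<in> S\<^sup>*" by simp
  then have "{(x, y). {x, y} \<in> E} \<subseteq> S\<^sup>*"
    using sym by (auto simp: S_def e_def doubleton_eq_iff dest: symD)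
  then have "{(x, y). {x, y} \<in> E}\<^sup>* \<subseteq> S\<^sup>*"
    using rtrancl_subset_rtrancl by blast
  then have "graph_connected V (E - {e})"
    using assms(1) unfolding graph_connected_def S_def by blast
  with e show ?thesis by blast
qed

text \<open>A connected subset of \<open>L\<close> with the fewest edges is acyclic, since an edge
  of a cycle could be deleted.\<close>

lemma spanning_tree_iff_connected:
  assumes "finite E" "L \<subseteq> E"
  shows "(\<exists>T\<subseteq>L. spanning_tree V E T) \<longleftrightarrow> graph_connected V L"
proof
  assume "\<exists>T\<subseteq>L. spanning_tree V E T"
  then show "graph_connected V L"
    by (auto simp: spanning_tree_def intro: graph_connected_mono)
next
  assume L: "graph_connected V L"
  define P where "P T \<longleftrightarrow> T \<subseteq> L \<and> graph_connected V T" for T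
  define T where "T = (ARG_MIN card T. P T)"
  have "P L" using L by (simp add: P_def)
  then have T: "P T"
    unfolding T_def by (rule arg_min_natI)
  have min: "card T \<le> card T'" if "P T'" for T'
    unfolding T_def using that by (rule arg_min_nat_le)
  have "finite T"
    using T assms finite_subset unfolding P_def by metis
  have "\<not> graph_cycle T p" for p
  proof
    assume "graph_cycle T p"
    then obtain e where "e \<in> T" "graph_connected V (T - {e})"
      using graph_connected_delete_cycle_edge T unfolding P_def by metis
    then have "card T \<le> card (T - {e})" using T by (intro min) (auto simp: P_def)
    then show False using card_Diff1_less[OF \<open>finite T\<close> \<open>e \<in> T\<close>] by simp
  qed
  then show "\<exists>T\<subseteq>L. spanning_tree V E T"
    using T assms(2) by (intro exI[of _ T]) (auto simp: spanning_tree_def P_def)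
qed

section \<open>Lattice points and powers of the maximal ideal\<close>

lemma Delta_iff: "a \<in> Delta D \<longleftrightarrow> mdeg a = D"
  by (simp add: Delta_def mdeg_UNIV)

text \<open>Coordinatewise comparable points with equal sums coincide. Applied in both directions,
  this supplies the two coordinates of an exchange step.\<close>

lemma Delta_exists_less:
  assumes a: "a \<in> Delta D" and b: "b \<in> Delta D" and "a \<noteq> b"
  shows "\<exists>i. lookup a i < lookup b i"
proof (rule ccontr)
  assume "\<nexists>i. lookup a i < lookup b i"
  then have "lookup b i \<le> lookup a i" for i by (simp add: not_less)
  moreover have "sum (lookup b) UNIV = sum (lookup a) UNIV"
    using a b by (simp add: Delta_def)
  ultimately have "lookup b i = lookup a i" for i
    by (intro sum_mono_inv[of "lookup b" UNIV "lookup a" i]) simp_all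
  then have "a = b" by (intro poly_mapping_eqI) simp
  with \<open>a \<noteq> b\<close> show False ..
qed

lemma mdeg_eq_zero_iff: "mdeg (u :: 'v::finite \<Rightarrow>\<^sub>0 nat) = 0 \<longleftrightarrow> u = 0"
  by (auto simp: mdeg_UNIV poly_mapping_eq_iff fun_eq_iff)

lemma mon_eq_iff [simp]: "mon u = (mon v :: ('v, 'k::comm_ring_1) mpoly) \<longleftrightarrow> u = v"
  unfolding mon_def by (auto dest: arg_cong[of _ _ keys])

text \<open>Subtraction of exponents is truncated; membership in the support is exactly what makes
  it reversible.\<close>

lemma Supp_add_eps:
  "i \<in> Supp c \<longleftrightarrow> c = (c - eps i) + eps i" for c :: "'n \<Rightarrow>\<^sub>0 nat"
proof
  assume "i \<in> Supp c"
  then show "c = (c - eps i) + eps i"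
    by (intro poly_mapping_eqI) (auto simp: lookup_add lookup_minus lookup_single when_def in_keys_iff)
next
  assume c: "c = (c - eps i) + eps i"
  then show "i \<in> Supp c"
    by (metis add_is_0 in_keys_iff lookup_add lookup_single_eq one_neq_zero)
qed

lemma down_verts_iff: "a \<in> down_verts c \<longleftrightarrow> (\<exists>i. c = a + eps i)"
proof
  assume "a \<in> down_verts c"
  then obtain i where i: "a = c - eps i" "i \<in> Supp c" by (auto simp: down_verts_def)
  then show "\<exists>i. c = a + eps i" using i(2)[unfolded Supp_add_eps] by metis
next
  assume "\<exists>i. c = a + eps i"
  then obtain i where i: "c = a + eps i" by blast
  then have "a = c - eps i" by simp
  moreover from this have "i \<in> Supp c" unfolding Supp_add_eps using i by metis
  ultimately show "a \<in> down_verts c" by (auto simp: down_verts_def)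
qed

lemma finite_down_edges: "finite (down_edges (c :: 'n::finite \<Rightarrow>\<^sub>0 nat))"
proof -
  have "down_edges c \<subseteq> (\<lambda>(i, j). {c - eps i, c - eps j}) ` UNIV"
    by (auto simp: down_edges_def)
  then show ?thesis by (rule finite_subset) simp
qed

lemma LS_subset_down_edges: "LS X c \<subseteq> down_edges c"
  by (auto simp: LS_def down_edges_def)

lemma down_verts_nonempty:
  assumes "c \<in> Delta (Suc D)"
  shows "down_verts c \<noteq> {}"
proof -
  have "Supp c \<noteq> {}" using assms by (auto simp: Delta_iff mdeg_def)
  then show ?thesis by (auto simp: down_verts_def)
qed

section \<open>Products of ideals and images of ideals under depolarization\<close>

lemma set_prod_commute: "set_prod S G = set_prod G S"
  unfolding set_prod_def by (metis mult.commute)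

lemma ideal_gen_mult':
  assumes "j \<in> ideal_gen S" "g \<in> G"
  shows "j * g \<in> ideal_gen (set_prod S G)"
  using ideal_gen_mult[OF assms(2,1)] by (simp add: set_prod_commute[of G] mult.commute)

lemma ideal_gen_set_prod_ideal_gen:
  "ideal_gen (set_prod (ideal_gen A) (ideal_gen B)) = ideal_gen (set_prod A B)" (is "?l = ?r")
proof
  have "a * b \<in> ideal_gen (set_prod A B)" if "a \<in> ideal_gen A" "b \<in> ideal_gen B" for a b
    using that(1) unfolding ideal_gen_def
  proof (induction rule: ideal.span_induct_alt)
    case base
    show ?case by (simp add: ideal.span_zero)
  next
    case (step c x y)
    have "c * (x * b) + y * b \<in> ideal.span (set_prod A B)"
      using ideal_gen_mult[OF step(1) that(2)] step(2) unfolding ideal_gen_def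
      by (rule ideal.span_add[OF ideal.span_scale])
    moreover have "(c * x + y) * b = c * (x * b) + y * b"
      by (simp add: algebra_simps)
    ultimately show ?case by simp
  qed
  then have "set_prod (ideal_gen A) (ideal_gen B) \<subseteq> ideal_gen (set_prod A B)"
    by (auto simp: set_prod_def)
  then show "?l \<subseteq> ?r" unfolding ideal_gen_def by (intro ideal.span_minimal) auto
  show "?r \<subseteq> ?l" unfolding ideal_gen_def
    by (intro ideal.span_mono set_prod_mono ideal.span_superset)
qed

lemma ideal_power_maximal:
  "ideal_power (ideal_gen (range var)) D =
    (ideal_gen (mon ` Delta D) :: ('n::finite, 'k::comm_ring_1) mpoly set)"
proof (induction D)
  case 0
  have "(p :: ('n, 'k) mpoly) * mon 0 \<in> ideal_gen (mon ` Delta 0)" for p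
    unfolding ideal_gen_def by (intro ideal.span_scale ideal.span_base imageI) (simp add: Delta_def)
  then show ?case by auto
next
  case (Suc D)
  have "set_prod (range var) (mon ` Delta D) = (mon ` Delta (Suc D) :: ('n, 'k) mpoly set)"
  proof (intro equalityI subsetI)
    fix x :: "('n, 'k) mpoly"
    assume "x \<in> set_prod (range var) (mon ` Delta D)"
    then obtain i a where "x = mon (eps i + a)" "a \<in> Delta D"
      by (auto simp: set_prod_def var_def mon_add)
    then show "x \<in> mon ` Delta (Suc D)" by (auto simp: Delta_iff mdeg_add)
  next
    fix x :: "('n, 'k) mpoly"
    assume "x \<in> mon ` Delta (Suc D)"
    then obtain c where c: "x = mon c" "c \<in> Delta (Suc D)" by auto
    then obtain a where a: "a \<in> down_verts c" using down_verts_nonempty by blast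
    then obtain i where i: "c = a + eps i" by (auto simp: down_verts_iff)
    then have "x = var i * mon a" "a \<in> Delta D"
      using c by (auto simp: var_def mon_add mult.commute Delta_iff mdeg_add)
    then show "x \<in> set_prod (range var) (mon ` Delta D)"
      by (auto simp: set_prod_def)
  qed
  then have "ideal_gen (set_prod (ideal_gen (range var)) (ideal_gen (mon ` Delta D)))
      = (ideal_gen (mon ` Delta (Suc D)) :: ('n, 'k) mpoly set)"
    by (simp add: ideal_gen_set_prod_ideal_gen)
  then show ?case by (simp add: Suc set_prod_def)
qed

lemma rename_id: "rename (\<lambda>v. v) p = p"
  by (induction p rule: mpoly_induct) simp_all

lemma image_depolarize_ideal_gen:
  fixes G :: "('n::finite \<times> 'd::{finite,linorder}, 'k::comm_ring_1) mpoly set"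
  shows "depolarize ` ideal_gen G = ideal_gen (depolarize ` G)"
proof (intro equalityI subsetI)
  fix q assume "q \<in> depolarize ` ideal_gen G"
  then obtain p where q: "q = depolarize p" and "p \<in> ideal_gen G" by auto
  then have "p \<in> ideal.span G" by (simp add: ideal_gen_def)
  then show "q \<in> ideal_gen (depolarize ` G)"
    unfolding q ideal_gen_def
  proof (induction rule: ideal.span_induct_alt)
    case (step c x y)
    then have "depolarize c * depolarize x + depolarize y \<in> ideal.span (depolarize ` G)"
      by (intro ideal.span_add[OF ideal.span_scale[OF ideal.span_base]]) simp_all
    then show ?case by (simp add: depolarize_eq_rename)
  qed (simp add: depolarize_eq_rename ideal.span_zero)
next
  fix q assume "q \<in> ideal_gen (depolarize ` G)"
  then show "q \<in> depolarize ` ideal_gen G"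
    unfolding ideal_gen_def
  proof (induction rule: ideal.span_induct_alt)
    case base
    have "0 = depolarize (0 :: ('n \<times> 'd, 'k) mpoly)" by (simp add: depolarize_eq_rename)
    then show ?case using ideal.span_zero by blast
  next
    case (step c x q)
    then obtain g p where g: "x = depolarize g" "g \<in> G" and p: "q = depolarize p" "p \<in> ideal.span G"
      by auto
    \<comment> \<open>Depolarization is surjective: sending each variable \<open>i\<close> to
      \<open>(i, Min UNIV)\<close> lifts the coefficient \<open>c\<close>.\<close>
    define c' where "c' = rename (\<lambda>i. (i, Min UNIV :: 'd)) c"
    have "c = depolarize c'"
      by (simp add: c'_def depolarize_eq_rename rename_rename rename_id)
    then have "c * x + q = depolarize (c' * g + p)"
      by (simp add: g p depolarize_eq_rename)
    moreover have "c' * g + p \<in> ideal.span G"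
      by (intro ideal.span_add ideal.span_scale ideal.span_base g p)
    ultimately show ?case by blast
  qed
qed

section \<open>Polarizations and linear syzygy edges\<close>

text \<open>The lift of a monomial along depolarization that uses only the first variable of each
  group.\<close>

definition base_mon :: "('n::finite \<Rightarrow>\<^sub>0 nat) \<Rightarrow> ('n \<times> 'd::{finite,linorder}, 'k::comm_ring_1) mpoly" where
  "base_mon w = mon (rename_exp (\<lambda>i. (i, Min UNIV)) w)"

lemma base_mon_add: "base_mon (w + w') = base_mon w * base_mon w'"
  by (simp add: base_mon_def rename_exp_add mon_add)

lemma rename_exp_rename_exp:
  "rename_exp \<phi> (rename_exp \<psi> u) = rename_exp (\<lambda>v. \<phi> (\<psi> v)) u"
  by (induction u rule: poly_mapping_single_induct) (simp_all add: rename_exp_add)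

lemma mon_diff_base_mon_in_ideal:
  fixes u :: "('n::{finite,linorder} \<times> 'd::{finite,linorder}) \<Rightarrow>\<^sub>0 nat"
  shows "mon u - base_mon (rename_exp fst u) \<in> ideal_gen (set (sigma :: ('n \<times> 'd, 'k::comm_ring_1) mpoly list))"
  by (simp add: ideal_sigma_iff base_mon_def rename_mon rename_exp_rename_exp base_var_def[abs_def])

context
  fixes X :: "'n::{finite,linorder} \<Rightarrow> ('n \<Rightarrow>\<^sub>0 nat) \<Rightarrow> 'd::{finite,linorder} set"
  assumes rank: "\<And>i a. a \<in> Delta CARD('d) \<Longrightarrow> card (X i a) = lookup a i"
begin

lemma rename_exp_m_exp:
  assumes "a \<in> Delta CARD('d)"
  shows "rename_exp fst (m_exp X a) = a"
proof -
  have "rename_exp fst (m_exp X a) = (\<Sum>i\<in>UNIV. \<Sum>j\<in>X i a. eps i)"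
    by (simp add: m_exp_def rename_exp_sum)
  also have "\<dots> = (\<Sum>i\<in>UNIV. single i (lookup a i))"
  proof (rule sum.cong)
    fix i :: 'n
    have "(\<Sum>j\<in>S. eps i) = single i (card S)" if "finite S" for S :: "'d set"
      using that by induction (simp_all flip: single_add)
    then show "(\<Sum>j\<in>X i a. eps i) = single i (lookup a i)"
      by (simp add: rank[OF assms])
  qed simp
  also have "\<dots> = a"
    by (rule poly_mapping_eqI) (simp add: lookup_sum lookup_single when_def)
  finally show ?thesis .
qed

lemma mdeg_m_exp:
  assumes "a \<in> Delta CARD('d)"
  shows "mdeg (m_exp X a) = CARD('d)"
proof -
  have "mdeg (m_exp X a) = (\<Sum>i\<in>UNIV. card (X i a))"
    by (simp add: m_exp_def mdeg_sum)
  then show ?thesis using assms by (simp add: rank Delta_def)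
qed

text \<open>The common factor \<open>u\<close> is eliminated in favour of an equality of two
  multiples of generators. Conversely, since \<open>i \<noteq> j\<close>, the variable
  \<open>(j, s)\<close> must divide the generator of \<open>a\<close>, and the quotient is
  \<open>u\<close>.\<close>

lemma is_linear_syzygy_iff:
  assumes c: "c \<in> Delta (CARD('d) + 1)" "c = a + eps i" "c = b + eps j" and "i \<noteq> j"
  shows "is_linear_syzygy X c i j \<longleftrightarrow>
    (\<exists>r s. single (i, r) 1 + m_exp X a = single (j, s) 1 + m_exp X b)"
proof
  have "c - eps i = a" by (simp add: c(2))
  moreover have "c - eps j = b" by (simp add: c(3))
  ultimately have ab: "c - eps i = a" "c - eps j = b" .
  {
    assume "is_linear_syzygy X c i j"
    then obtain u r s where "m_exp X a = single (j, r) 1 + u" "m_exp X b = single (i, s) 1 + u"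
      unfolding is_linear_syzygy_def ab by blast
    then have "single (i, s) 1 + m_exp X a = single (j, r) 1 + m_exp X b"
      by (simp add: ac_simps)
    then show "\<exists>r s. single (i, r) 1 + m_exp X a = single (j, s) 1 + m_exp X b" by blast
  }
  assume "\<exists>r s. single (i, r) 1 + m_exp X a = single (j, s) 1 + m_exp X b"
  then obtain r s where eq: "single (i, r) 1 + m_exp X a = single (j, s) 1 + m_exp X b" by blast
  then have "lookup (single (i, r) 1 + m_exp X a) (j, s) = lookup (single (j, s) 1 + m_exp X b) (j, s)"
    by simp
  then have "lookup (m_exp X a) (j, s) > 0"
    using \<open>i \<noteq> j\<close> by (simp add: lookup_add lookup_single)
  then obtain u where u: "m_exp X a = single (j, s) 1 + u" by (rule single_split)
  then have "single (j, s) 1 + m_exp X b = single (j, s) 1 + (single (i, r) 1 + u)"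
    using eq by (simp add: ac_simps)
  then have u': "m_exp X b = single (i, r) 1 + u" by (simp only: add_left_cancel)
  have "a \<in> Delta CARD('d)" using c by (simp add: Delta_iff mdeg_add)
  then have "mdeg u = CARD('d) - 1" using mdeg_m_exp[of a] by (simp add: u mdeg_add)
  then show "is_linear_syzygy X c i j"
    unfolding is_linear_syzygy_def ab using u u' by blast
qed

lemma LS_iff:
  assumes c: "c \<in> Delta (CARD('d) + 1)"
  shows "{a, b} \<in> LS X c \<longleftrightarrow> (\<exists>i j r s. i \<noteq> j \<and> c = a + eps i \<and> c = b + eps j \<and>
    single (i, r) 1 + m_exp X a = single (j, s) 1 + m_exp X b)" (is "_ \<longleftrightarrow> ?R a b")
proof
  assume "{a, b} \<in> LS X c"
  then obtain i j where ij: "{a, b} = {c - eps i, c - eps j}" "i \<in> Supp c" "j \<in> Supp c" "i \<noteq> j"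
      "is_linear_syzygy X c i j"
    unfolding LS_def by blast
  note c' = ij(2,3)[unfolded Supp_add_eps]
  have "?R (c - eps i) (c - eps j)"
    using is_linear_syzygy_iff[OF c c' ij(4)] c' ij(4,5) by blast
  moreover have "?R x y \<Longrightarrow> ?R y x" for x y by metis
  moreover have "a = c - eps i \<and> b = c - eps j \<or> a = c - eps j \<and> b = c - eps i"
    using ij(1) by (auto simp: doubleton_eq_iff)
  ultimately show "?R a b" by (elim disjE) simp_all
next
  assume "?R a b"
  then obtain i j r s where ij: "i \<noteq> j" "c = a + eps i" "c = b + eps j"
    and eq: "single (i, r) 1 + m_exp X a = single (j, s) 1 + m_exp X b" by blast
  have "is_linear_syzygy X c i j"
    using is_linear_syzygy_iff[OF c ij(2,3,1)] eq by blast
  moreover have "a = c - eps i" "i \<in> Supp c"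
    using ij(2) by (simp_all add: in_keys_iff lookup_add)
  moreover have "b = c - eps j" "j \<in> Supp c"
    using ij(3) by (simp_all add: in_keys_iff lookup_add)
  ultimately show "{a, b} \<in> LS X c"
    unfolding LS_def using ij(1) by blast
qed

definition gens :: "('n \<times> 'd, 'k::comm_ring_1) mpoly set" where
  "gens = (\<lambda>a. mon (m_exp X a)) ` Delta CARD('d)"

definition sigma_J :: "('n \<times> 'd, 'k::comm_ring_1) mpoly set" where
  "sigma_J = ideal_gen (set_prod (set sigma) gens)"

lemma J_ideal_eq: "J_ideal X = ideal_gen gens"
  unfolding J_ideal_def gens_def by (rule arg_cong[of _ _ ideal_gen]) auto

lemma depolarize_gen:
  assumes "a \<in> Delta CARD('d)"
  shows "depolarize (mon (m_exp X a)) = mon a"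
  by (simp add: depolarize_eq_rename rename_mon rename_exp_m_exp[OF assms])

text \<open>Rank preservation makes the generator of \<open>a\<close> depolarize to the monomial of
  \<open>a\<close>, so the image of the ideal is the required power. What remains is the regularity
  of \<open>sigma\<close>, with \<open>1\<close> excluded from \<open>gens\<close> because their
  degree is positive.\<close>

lemma is_polarization_iff:
  "is_polarization (J_ideal X :: ('n \<times> 'd, 'k::comm_ring_1) mpoly set) (ideal_power (ideal_gen (range var)) CARD('d))
    \<longleftrightarrow> (\<forall>p \<in> ideal_gen (gens :: ('n \<times> 'd, 'k) mpoly set). depolarize p = 0 \<longrightarrow> p \<in> sigma_J)"
proof -
  have "depolarize ` (gens :: ('n \<times> 'd, 'k) mpoly set) = mon ` Delta CARD('d)"
    by (force simp: gens_def image_image depolarize_gen)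
  then have "depolarize ` (J_ideal X :: ('n \<times> 'd, 'k) mpoly set) = ideal_power (ideal_gen (range var)) CARD('d)"
    by (simp add: J_ideal_eq image_depolarize_ideal_gen ideal_power_maximal)
  moreover have "(1 :: ('n \<times> 'd, 'k) mpoly) \<notin> gens"
  proof
    assume "(1 :: ('n \<times> 'd, 'k) mpoly) \<in> gens"
    then obtain a where a: "a \<in> Delta CARD('d)" "mon 0 = (mon (m_exp X a) :: ('n \<times> 'd, 'k) mpoly)"
      by (auto simp: gens_def)
    then have "m_exp X a = 0" by (metis mon_eq_iff)
    then have "mdeg (m_exp X a) = 0" by (simp add: mdeg_eq_zero_iff)
    then show False using mdeg_m_exp[OF a(1)] by simp
  qed
  moreover have "(gens :: ('n \<times> 'd, 'k) mpoly set) \<subseteq> range mon" by (auto simp: gens_def)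
  ultimately show ?thesis
    by (simp add: is_polarization_def J_ideal_eq regular_sigma_iff sigma_J_def)
qed

section \<open>Relations modulo \<open>sigma_J\<close> obtained from linear syzygies\<close>

lemma sigma_J_ideal:
  "p \<in> sigma_J \<Longrightarrow> q \<in> sigma_J \<Longrightarrow> p + q \<in> sigma_J"
  "p \<in> sigma_J \<Longrightarrow> q \<in> sigma_J \<Longrightarrow> p - q \<in> sigma_J"
  "q \<in> sigma_J \<Longrightarrow> p * q \<in> sigma_J"
  "0 \<in> sigma_J"
  unfolding sigma_J_def ideal_gen_def
  by (rule ideal.span_add ideal.span_diff ideal.span_scale ideal.span_zero; assumption)+

text \<open>Modulo \<open>sigma_J\<close>, the cofactor of a generator matters only through its
  depolarization.\<close>

lemma sigma_J_base:
  assumes "a \<in> Delta CARD('d)"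
  shows "mon u * mon (m_exp X a) - base_mon (rename_exp fst u) * mon (m_exp X a) \<in> sigma_J"
proof -
  have "(mon u - base_mon (rename_exp fst u)) * mon (m_exp X a) \<in> sigma_J"
    unfolding sigma_J_def using assms
    by (intro ideal_gen_mult' mon_diff_base_mon_in_ideal) (auto simp: gens_def)
  then show ?thesis by (simp add: left_diff_distrib)
qed

text \<open>A linear syzygy equates two multiples of generators by variables; replacing both
  variables by base variables changes each side by an element of \<open>sigma_J\<close>.\<close>

lemma sigma_J_LS:
  fixes c :: "'n \<Rightarrow>\<^sub>0 nat"
  assumes c: "c \<in> Delta (CARD('d) + 1)" and "{a, b} \<in> LS X c"
  shows "(base_mon (c - a) * mon (m_exp X a) - base_mon (c - b) * mon (m_exp X b)
    :: ('n \<times> 'd, 'k::comm_ring_1) mpoly) \<in> sigma_J"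
proof -
  obtain i j r s where ij: "c = a + eps i" "c = b + eps j"
    and eq: "single (i, r) 1 + m_exp X a = single (j, s) 1 + m_exp X b"
    using assms(2) unfolding LS_iff[OF c] by blast
  have ab: "a \<in> Delta CARD('d)" "b \<in> Delta CARD('d)"
    using c[unfolded ij(1)] c[unfolded ij(2)] by (simp_all add: Delta_iff mdeg_add)
  have "c - a = eps i" "c - b = eps j"
    by (simp add: ij(1)) (simp add: ij(2))
  moreover have "mon (single (i, r) 1) * mon (m_exp X a) = (mon (single (j, s) 1) * mon (m_exp X b) :: ('n \<times> 'd, 'k) mpoly)"
    using eq by (metis mon_add)
  moreover have "(mon (single (j, s) 1) * mon (m_exp X b) - base_mon (rename_exp fst (single (j, s) 1)) * mon (m_exp X b))
      - (mon (single (i, r) 1) * mon (m_exp X a) - base_mon (rename_exp fst (single (i, r) 1)) * mon (m_exp X a))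
      \<in> (sigma_J :: ('n \<times> 'd, 'k) mpoly set)"
    by (intro sigma_J_ideal(2) sigma_J_base ab)
  ultimately show ?thesis by simp
qed

lemma sigma_J_connected:
  assumes c: "c \<in> Delta (CARD('d) + 1)" and "graph_connected (down_verts c) (LS X c)"
    and ab: "a \<in> down_verts c" "b \<in> down_verts c"
  shows "(base_mon (c - a) * mon (m_exp X a) - base_mon (c - b) * mon (m_exp X b)
    :: ('n \<times> 'd, 'k::comm_ring_1) mpoly) \<in> sigma_J"
proof -
  have "(a, b) \<in> {(x, y). {x, y} \<in> LS X c}\<^sup>*"
    using assms(2) ab by (auto simp: graph_connected_def)
  then show ?thesis
  proof induction
    case base
    show ?case by (simp add: sigma_J_ideal(4))
  next
    case (step b b')
    then show ?case
      using sigma_J_ideal(1)[OF step.IH sigma_J_LS[OF c, of b b']] by simp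
  qed
qed

text \<open>The same monomial is reached from two generators. One unit of \<open>a\<close> at a
  coordinate \<open>i\<close> in excess over \<open>a'\<close> is exchanged for one at a coordinate
  \<open>j\<close> in deficit. The old and the new point are vertices of the down-graph of
  \<open>a + eps j\<close>, where connectedness applies, and the excess \<open>mdeg (a - a')\<close>
  drops.\<close>

lemma sigma_J_swap:
  assumes conn: "\<And>c. c \<in> Delta (CARD('d) + 1) \<Longrightarrow> graph_connected (down_verts c) (LS X c)"
    and "a \<in> Delta CARD('d)" "a' \<in> Delta CARD('d)" "a + w = a' + w'"
  shows "(base_mon w * mon (m_exp X a) - base_mon w' * mon (m_exp X a')
    :: ('n \<times> 'd, 'k::comm_ring_1) mpoly) \<in> sigma_J"
  using assms(2-)
proof (induction "mdeg (a - a')" arbitrary: a w rule: less_induct)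
  case less
  show ?case
  proof (cases "a = a'")
    case True
    then show ?thesis using less.prems(3) by (simp add: sigma_J_ideal(4))
  next
    case False
    then obtain i where i: "lookup a i > lookup a' i"
      using Delta_exists_less[OF less.prems(2,1)] by auto
    obtain j where j: "lookup a j < lookup a' j"
      using Delta_exists_less[OF less.prems(1,2) False] by auto
    \<comment> \<open>The deficit of \<open>a\<close> at \<open>j\<close> must be made up by
      \<open>w\<close>, so \<open>w\<close> has a unit at \<open>j\<close> to give away.\<close>
    have "lookup a j + lookup w j = lookup a' j + lookup w' j"
      using less.prems(3) by (metis lookup_add)
    then have "lookup w j > 0" using j by simp
    then obtain w1 where w1: "w = eps j + w1" by (rule single_split)
    have "lookup a i > 0" using i by simp
    then obtain a0 where a0: "a = eps i + a0" by (rule single_split)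
    define b where "b = a0 + eps j"
    have c: "a + eps j \<in> Delta (CARD('d) + 1)"
      using less.prems(1) by (simp add: Delta_iff mdeg_add)
    have b: "b \<in> Delta CARD('d)" "b + eps i = a + eps j"
      using less.prems(1) by (simp_all add: Delta_iff mdeg_add a0 b_def ac_simps)
    \<comment> \<open>Subtraction is truncated: the added unit at \<open>j\<close> stays invisible
      because \<open>a\<close> is strictly below \<open>a'\<close> there.\<close>
    have "a - a' = eps i + (b - a')"
    proof (rule poly_mapping_eqI)
      fix l
      have "i \<noteq> j" using i j by auto
      then show "lookup (a - a') l = lookup (eps i + (b - a')) l"
        using i j by (auto simp: a0 b_def lookup_minus lookup_add lookup_single when_def)
    qed
    then have "mdeg (b - a') < mdeg (a - a')" by (simp add: mdeg_add)
    then have IH: "(base_mon (eps i + w1) * mon (m_exp X b) - base_mon w' * mon (m_exp X a')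
        :: ('n \<times> 'd, 'k) mpoly) \<in> sigma_J"
      using b less.prems(2,3) by (intro less.hyps) (simp_all add: w1 a0 b_def ac_simps)
    have "(base_mon (eps j) * mon (m_exp X a) - base_mon (eps i) * mon (m_exp X b)
        :: ('n \<times> 'd, 'k) mpoly) \<in> sigma_J"
    proof -
      have "a \<in> down_verts (a + eps j)" "b \<in> down_verts (a + eps j)"
        unfolding down_verts_iff using b(2) by metis+
      moreover have "a + eps j - b = eps i"
        unfolding b(2)[symmetric] by simp
      ultimately show ?thesis
        using sigma_J_connected[OF c conn[OF c], of a b] by simp
    qed
    then have "base_mon w1 * (base_mon (eps j) * mon (m_exp X a) - base_mon (eps i) * mon (m_exp X b))
        + (base_mon (eps i + w1) * mon (m_exp X b) - base_mon w' * mon (m_exp X a') :: ('n \<times> 'd, 'k) mpoly) \<in> sigma_J"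
      by (intro sigma_J_ideal(1)[OF sigma_J_ideal(3)] IH)
    then show ?thesis by (simp add: w1 base_mon_add algebra_simps)
  qed
qed

text \<open>Modulo \<open>sigma_J\<close>, an element of the ideal is determined by its depolarization.\<close>

lemma in_sigma_J_if_connected:
  assumes conn: "\<And>c. c \<in> Delta (CARD('d) + 1) \<Longrightarrow> graph_connected (down_verts c) (LS X c)"
    and p: "p \<in> ideal_gen gens" "depolarize p = 0"
  shows "(p :: ('n \<times> 'd, 'k::comm_ring_1) mpoly) \<in> sigma_J"
proof -
  \<comment> \<open>Any choice will do, since \<open>sigma_J_swap\<close> makes all candidates with
    the same exponent \<open>e\<close> congruent.\<close>
  define rep :: "('n \<Rightarrow>\<^sub>0 nat) \<Rightarrow> ('n \<times> 'd, 'k) mpoly" where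
    "rep e = (SOME q. \<exists>a w. a \<in> Delta CARD('d) \<and> e = a + w \<and> q = base_mon w * mon (m_exp X a))" for e
  have rep: "\<exists>a' w'. a' \<in> Delta CARD('d) \<and> a + w = a' + w' \<and> rep (a + w) = base_mon w' * mon (m_exp X a')"
    if "a \<in> Delta CARD('d)" for a w
    unfolding rep_def by (rule someI_ex) (use that in blast)
  have monomial: "mon u * mon (m_exp X a) - rep (a + rename_exp fst u) \<in> sigma_J"
    if a: "a \<in> Delta CARD('d)" for a u
  proof -
    obtain a' w' where a': "a' \<in> Delta CARD('d)" "a + rename_exp fst u = a' + w'"
      "rep (a + rename_exp fst u) = base_mon w' * mon (m_exp X a')"
      using rep[OF a] by blast
    have "(mon u * mon (m_exp X a) - base_mon (rename_exp fst u) * mon (m_exp X a))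
        + (base_mon (rename_exp fst u) * mon (m_exp X a) - base_mon w' * mon (m_exp X a')) \<in> (sigma_J :: ('n \<times> 'd, 'k) mpoly set)"
      by (intro sigma_J_ideal(1) sigma_J_base sigma_J_swap conn a a'(1,2))
    then show ?thesis by (simp add: a'(3))
  qed
  \<comment> \<open>\<open>?T\<close> is additive and depends only on the depolarization, so it
    vanishes at the given \<open>p\<close>; it remains to show that \<open>p\<close> is congruent to
    \<open>?T p\<close>.\<close>
  let ?T = "\<lambda>p. lin const_scale rep (depolarize p)"
  have add_T: "?T (p + q) = ?T p + ?T q" for p q :: "('n \<times> 'd, 'k) mpoly"
    by (simp add: depolarize_eq_rename pol.lin_add)
  have mult: "x * mon (m_exp X a) - ?T (x * mon (m_exp X a)) \<in> sigma_J" if a: "a \<in> Delta CARD('d)" for x a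
  proof (induction x rule: poly_mapping_single_induct)
    case (single u r)
    have "?T (single u r * mon (m_exp X a)) = const r * rep (a + rename_exp fst u)"
      by (simp add: mon_def mult_single depolarize_eq_rename rename_single rename_exp_add
          rename_exp_m_exp[OF a] pol.lin_single add.commute)
    moreover have "const r * (mon u * mon (m_exp X a) - rep (a + rename_exp fst u)) \<in> sigma_J"
      by (intro sigma_J_ideal(3) monomial a)
    ultimately show ?case by (simp add: single_eq_const_mon[of u r] right_diff_distrib mult.assoc)
  next
    case (add x y)
    then have "(x * mon (m_exp X a) - ?T (x * mon (m_exp X a)))
        + (y * mon (m_exp X a) - ?T (y * mon (m_exp X a))) \<in> sigma_J"
      by (rule sigma_J_ideal)
    then show ?case by (simp only: distrib_right add_T add_diff_add)
  qed
  have "p - ?T p \<in> sigma_J"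
    using p(1) unfolding ideal_gen_def
  proof (induction rule: ideal.span_induct_alt)
    case base
    show ?case by (simp add: depolarize_eq_rename pol.lin_zero sigma_J_ideal)
  next
    case (step x g q)
    then obtain a where "a \<in> Delta CARD('d)" "g = mon (m_exp X a)" by (auto simp: gens_def)
    then have "(x * g - ?T (x * g)) + (q - ?T q) \<in> sigma_J"
      using mult step(2) by (intro sigma_J_ideal(1)) auto
    then show ?case by (simp only: add_T add_diff_add)
  qed
  then show ?thesis by (simp add: p(2) pol.lin_zero)
qed

text \<open>The functional \<open>\<Phi>\<close> sums the coefficients at the monomials coming from
  the component of \<open>a\<close>. It vanishes on \<open>sigma_J\<close>, and its value on a
  difference of two multiples of generators tells whether \<open>b\<close> lies in that
  component.\<close>

lemma connected_if_in_sigma_J: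
  assumes inter: "\<And>p :: ('n \<times> 'd, 'k::comm_ring_1) mpoly. p \<in> ideal_gen gens \<Longrightarrow> depolarize p = 0 \<Longrightarrow> p \<in> sigma_J"
    and c: "c \<in> Delta (CARD('d) + 1)"
  shows "graph_connected (down_verts c) (LS X c)"
  unfolding graph_connected_def
proof (intro conjI ballI)
  show "down_verts c \<noteq> {}" using down_verts_nonempty[of c "CARD('d)"] c by simp
next
  fix a b assume "a \<in> down_verts c" "b \<in> down_verts c"
  then obtain i j where ij: "c = a + eps i" "c = b + eps j" unfolding down_verts_iff by blast
  have Delta: "v \<in> Delta CARD('d)" if "c = v + eps l" for v l
    using c that by (simp add: Delta_iff mdeg_add)
  define C where "C = {v. (a, v) \<in> {(x, y). {x, y} \<in> LS X c}\<^sup>*}"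
  define U where "U = {single (l, r) 1 + m_exp X v | v l r. v \<in> C \<and> c = v + eps l}"
  have "U \<subseteq> (\<lambda>(l, r). single (l, r) 1 + m_exp X (c - eps l)) ` UNIV"
  proof
    fix u assume "u \<in> U"
    then obtain v l r where v: "u = single (l, r) 1 + m_exp X v" "c = v + eps l"
      unfolding U_def by blast
    then have "v = c - eps l" by simp
    with v(1) show "u \<in> (\<lambda>(l, r). single (l, r) 1 + m_exp X (c - eps l)) ` UNIV"
      by (intro image_eqI[of _ _ "(l, r)"]) simp_all
  qed
  then have "finite U" by (rule finite_subset) simp
  \<comment> \<open>Membership in \<open>U\<close> is independent of how the monomial is written:
    depolarizing shows that both writings belong to \<open>c\<close>, and if they use different
    vertices, their equality is a linear syzygy edge, which stays in the component.\<close>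
  have U_iff: "single (l, r) 1 + m_exp X v \<in> U \<longleftrightarrow> v \<in> C \<and> c = v + eps l"
    if v: "v \<in> Delta CARD('d)" for l r v
  proof
    assume "single (l, r) 1 + m_exp X v \<in> U"
    then obtain v' l' r' where v': "v' \<in> C" "c = v' + eps l'"
      and eq: "single (l', r') 1 + m_exp X v' = single (l, r) 1 + m_exp X v"
      unfolding U_def by (smt (verit) mem_Collect_eq)
    have "eps l' + v' = eps l + v"
      using arg_cong[OF eq, of "rename_exp fst"] v Delta[OF v'(2)]
      by (simp add: rename_exp_add rename_exp_m_exp)
    then have c': "c = v + eps l" using v'(2) by (simp add: add.commute)
    have "v \<in> C"
    proof (cases "l' = l")
      case True
      then have "v' = v" using c' v'(2) by simp
      then show ?thesis using v'(1) by simp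
    next
      case False
      then have "{v', v} \<in> LS X c" using LS_iff[OF c] v'(2) c' eq by blast
      then show ?thesis using v'(1) unfolding C_def by (auto intro: rtrancl_into_rtrancl)
    qed
    with c' show "v \<in> C \<and> c = v + eps l" by simp
  qed (auto simp: U_def)
  have U_deg: "mdeg u = CARD('d) + 1" if "u \<in> U" for u
    using that Delta mdeg_m_exp by (auto simp: U_def mdeg_add)
  define \<Phi> where "\<Phi> p = (\<Sum>u\<in>U. lookup p u)" for p :: "('n \<times> 'd, 'k) mpoly"
  have add: "\<Phi> (p + q) = \<Phi> p + \<Phi> q" for p q
    by (simp add: \<Phi>_def lookup_add sum.distrib)
  have diff: "\<Phi> (p - q) = \<Phi> p - \<Phi> q" for p q
    by (simp add: \<Phi>_def lookup_minus sum_subtractf)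
  have scale: "\<Phi> (const k * p) = k * \<Phi> p" for k p
    by (simp add: \<Phi>_def lookup_const_mult sum_distrib_left)
  have mon: "\<Phi> (mon u) = (if u \<in> U then 1 else 0)" for u
    using \<open>finite U\<close> by (simp add: \<Phi>_def lookup_mon when_def)
  have \<Phi>_J: "\<Phi> p = 0" if "p \<in> sigma_J" for p
    using that unfolding sigma_J_def ideal_gen_def
  proof (induction rule: ideal.span_induct_alt)
    case base
    show ?case by (simp add: \<Phi>_def)
  next
    case (step x z p)
    then obtain l r v where z: "z = mon (single (l, Min UNIV) 1 + m_exp X v) - mon (single (l, r) 1 + m_exp X v)"
      and v: "v \<in> Delta CARD('d)"
      by (auto simp: set_prod_def sigma_eq var_diff_def gens_def var_def mon_add left_diff_distrib)
    have "\<Phi> (x * z) = 0"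
    proof (induction x rule: poly_mapping_single_induct)
      case (single w k)
      \<comment> \<open>For \<open>w = 0\<close> the criterion \<open>U_iff\<close> does not involve
        the second index of the variable; for \<open>w \<noteq> 0\<close> both exponents have too
        large a degree for \<open>U\<close>.\<close>
      have "w + (single (l, Min UNIV) 1 + m_exp X v) \<in> U \<longleftrightarrow> w + (single (l, r) 1 + m_exp X v) \<in> U"
      proof (cases "w = 0")
        case True
        then show ?thesis using U_iff[OF v] by simp
      next
        case False
        then have "mdeg w > 0" using mdeg_eq_zero_iff[of w] by auto
        then have "w + (single (l, s) 1 + m_exp X v) \<notin> U" for s
          using U_deg[of "w + (single (l, s) 1 + m_exp X v)"] mdeg_m_exp[OF v] by (auto simp: mdeg_add)
        then show ?thesis by blast
      qed
      then have "\<Phi> (mon w * z) = 0"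
        by (simp only: z right_diff_distrib diff mon flip: mon_add) simp
      then show ?case by (simp add: single_eq_const_mon scale mult.assoc)
    qed (simp add: distrib_right add)
    then show ?case using step by (simp add: add)
  qed
  \<comment> \<open>The test element: both terms depolarize to the monomial of
    \<open>c\<close>.\<close>
  define p :: "('n \<times> 'd, 'k) mpoly" where
    "p = mon (single (i, Min UNIV) 1 + m_exp X a) - mon (single (j, Min UNIV) 1 + m_exp X b)"
  have "p \<in> ideal_gen gens"
    unfolding p_def mon_add ideal_gen_def gens_def
    by (intro ideal.span_diff ideal.span_scale ideal.span_base imageI Delta[OF ij(1)] Delta[OF ij(2)])
  moreover have "depolarize p = 0"
    using ij by (simp add: p_def depolarize_eq_rename rename_mon rename_exp_add
        rename_exp_m_exp Delta[OF ij(1)] Delta[OF ij(2)] add.commute)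
  ultimately have "\<Phi> p = 0" using inter \<Phi>_J by blast
  moreover have "a \<in> C" by (simp add: C_def)
  ultimately have "b \<in> C"
    using U_iff[OF Delta[OF ij(1)]] U_iff[OF Delta[OF ij(2)]] ij
    by (auto simp: p_def diff mon split: if_splits)
  then show "(a, b) \<in> {(x, y). {x, y} \<in> LS X c}\<^sup>*" by (simp add: C_def)
qed

lemma is_polarization_iff_connected:
  "is_polarization (J_ideal X :: ('n \<times> 'd, 'k::comm_ring_1) mpoly set) (ideal_power (ideal_gen (range var)) CARD('d))
    \<longleftrightarrow> (\<forall>c\<in>Delta (CARD('d) + 1). graph_connected (down_verts c) (LS X c))"
  unfolding is_polarization_iff
  using in_sigma_J_if_connected connected_if_in_sigma_J by metis

end

section \<open>The Schur module\<close>

lemma mem_ext_sym_part: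
  "x \<in> ext_sym_part a b \<longleftrightarrow> (\<forall>A u. lookup (lookup x A) u \<noteq> 0 \<longrightarrow> card A = a \<and> mdeg u = b)"
proof
  assume x: "x \<in> ext_sym_part a b"
  show "\<forall>A u. lookup (lookup x A) u \<noteq> 0 \<longrightarrow> card A = a \<and> mdeg u = b"
  proof (intro allI impI)
    fix A u assume u: "lookup (lookup x A) u \<noteq> 0"
    then have "A \<in> keys x" "u \<in> keys (lookup x A)" by (auto simp: in_keys_iff)
    then show "card A = a \<and> mdeg u = b" using x by (auto simp: ext_sym_part_def)
  qed
next
  assume *: "\<forall>A u. lookup (lookup x A) u \<noteq> 0 \<longrightarrow> card A = a \<and> mdeg u = b"
  have "card A = a" if "A \<in> keys x" for A
  proof -
    have "lookup x A \<noteq> 0" using that by (simp add: in_keys_iff)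
    then obtain u where "lookup (lookup x A) u \<noteq> 0"
      by (metis poly_mapping_eqI lookup_zero)
    then show ?thesis using * by blast
  qed
  then show "x \<in> ext_sym_part a b"
    using * by (simp add: ext_sym_part_def in_keys_iff)
qed

lemma scale_single: "scale r (single A p) = single A (const r * p)"
  by (rule poly_mapping_eqI) (simp add: lookup_scale lookup_single when_def)

lemma kappa_add: "kappa (x + y) = kappa x + kappa y"
  by (simp add: kappa_def lookup_add distrib_left single_add sum.distrib)

lemma kappa_scale: "kappa (scale r x) = scale r (kappa x)"
  by (simp add: kappa_def lookup_scale ext.scale_sum_right scale_single mult.left_commute)

lemma kappa_zero: "kappa 0 = 0"
  by (simp add: kappa_def)

lemma subspace_schur_L: "ext.subspace (schur_L D E :: ('n::{finite,linorder}, 'r::comm_ring_1) ext_sym set)"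
proof (rule ext.subspaceI)
  show "0 \<in> schur_L D E" by (simp add: schur_L_def mem_ext_sym_part kappa_zero)
next
  fix x y :: "('n, 'r) ext_sym" assume xy: "x \<in> schur_L D E" "y \<in> schur_L D E"
  have "lookup (lookup x A) u \<noteq> 0 \<or> lookup (lookup y A) u \<noteq> 0"
    if "lookup (lookup (x + y) A) u \<noteq> 0" for A u
    using that by (auto simp: lookup_add)
  then show "x + y \<in> schur_L D E"
    using xy unfolding schur_L_def mem_ext_sym_part mem_Collect_eq kappa_add by fastforce
next
  fix r and x :: "('n, 'r) ext_sym" assume x: "x \<in> schur_L D E"
  have "lookup (lookup x A) u \<noteq> 0" if "lookup (lookup (scale r x) A) u \<noteq> 0" for A u
    using that by (auto simp: lookup_scale lookup_const_mult)
  then show "scale r x \<in> schur_L D E"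
    using x unfolding schur_L_def mem_ext_sym_part mem_Collect_eq kappa_scale
    by (metis ext.scale_zero_right)
qed

text \<open>The basis element f_i \<otimes> f^u in exterior degree one.\<close>

definition std :: "'n \<Rightarrow> ('n \<Rightarrow>\<^sub>0 nat) \<Rightarrow> ('n, 'r::comm_ring_1) ext_sym" where
  "std i u = single {i} (mon u)"

lemma lookup_std: "lookup (lookup (std i u) {j}) v = (if i = j \<and> u = v then 1 else 0)"
  by (simp add: std_def lookup_single lookup_mon when_def)

lemma std_in_part: "mdeg u = b \<Longrightarrow> std i u \<in> ext_sym_part 1 b"
  by (auto simp: std_def mem_ext_sym_part lookup_single lookup_mon when_def split: if_splits)

lemma kappa_single:
  "kappa (single A p) = (\<Sum>i\<in>A. single (A - {i}) ((-1) ^ card {j\<in>A. i < j} * (var i * p)))"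
proof -
  have "kappa (single A p) = (\<Sum>B\<in>UNIV. if A = B then
      (\<Sum>i\<in>B. single (B - {i}) ((-1) ^ card {j\<in>B. i < j} * (var i * p))) else 0)"
    unfolding kappa_def by (rule sum.cong) (auto simp: lookup_single)
  then show ?thesis by simp
qed

lemma kappa_single_singleton: "kappa (single {i} p) = single {} (var i * p)"
proof -
  have "kappa (single {i} p) = single ({i} - {i}) ((-1) ^ card {j\<in>{i}. i < j} * (var i * p))"
    by (simp add: kappa_single)
  moreover have "{j\<in>{i}. i < j} = {}" by auto
  ultimately show ?thesis by (simp del: Collect_empty_eq)
qed

lemma kappa_std: "kappa (std i u) = single {} (mon (u + eps i))"
  by (simp add: std_def kappa_single_singleton var_def add.commute flip: mon_add)

text \<open>Moving f_i behind f_j costs a sign, whereas f_j is already in the last position.\<close>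

lemma kappa_hook:
  assumes "i < j"
  shows "kappa (hook i j u) = std i (u + eps j) - std j (u + eps i)"
proof -
  have sets: "{k \<in> {i, j}. i < k} = {j}" "{k \<in> {i, j}. j < k} = {}" "{i, j} - {i} = {j}" "{i, j} - {j} = {i}"
    using assms by auto
  have "kappa (hook i j u) = single ({i, j} - {i}) ((-1) ^ card {k\<in>{i, j}. i < k} * (var i * mon u))
      + single ({i, j} - {j}) ((-1) ^ card {k\<in>{i, j}. j < k} * (var j * mon u))"
    using assms by (simp add: hook_def kappa_single)
  then show ?thesis
    unfolding sets by (simp add: std_def var_def mon_add mult.commute single_uminus)
qed

lemma schur_L_1_relation:
  assumes "mdeg a = b" "mdeg a' = b" "a + eps i = a' + eps j"
  shows "(std i a - std j a' :: ('n::{finite,linorder}, 'r::comm_ring_1) ext_sym) \<in> schur_L 1 b"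
proof -
  have diff: "lookup (lookup (std i a) A) u \<noteq> (0 :: 'r) \<or> lookup (lookup (std j a') A) u \<noteq> (0 :: 'r)"
    if "lookup (lookup (std i a - std j a') A) u \<noteq> (0 :: 'r)" for A u
    using that by (auto simp: lookup_minus)
  have "std i a - std j a' \<in> (ext_sym_part 1 b :: ('n, 'r) ext_sym set)"
    using diff std_in_part[OF assms(1), of i, where 'b='r] std_in_part[OF assms(2), of j, where 'b='r]
    unfolding mem_ext_sym_part by blast
  moreover have "kappa (std i a - std j a') + kappa (std j a' :: ('n, 'r) ext_sym) = kappa (std i a)"
    by (simp flip: kappa_add)
  then have "kappa (std i a - std j a' :: ('n, 'r) ext_sym) = 0"
    using assms(3) by (simp add: kappa_std)
  ultimately show ?thesis by (simp add: schur_L_def)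
qed

lemma LS_cases:
  assumes "{a, b} \<in> LS X c" "c = a + eps i" "c = b + eps j"
  shows "i \<noteq> j" "i \<in> Supp c" "j \<in> Supp c" "a = c - eps i" "b = c - eps j"
proof -
  obtain i' j' where ij: "{a, b} = {c - eps i', c - eps j'}" "i' \<in> Supp c" "j' \<in> Supp c" "i' \<noteq> j'"
    using assms(1) unfolding LS_def by blast
  have uniq: "l = l'" if "c = v + eps l" "c = v + eps l'" for v l l'
  proof -
    have "eps l = eps l'" using that by simp
    then have "lookup (eps l) l = lookup (eps l') l" by simp
    then show ?thesis by (simp add: lookup_single when_def split: if_splits)
  qed
  note c' = ij(2,3)[unfolded Supp_add_eps]
  have "a = c - eps i' \<and> b = c - eps j' \<or> a = c - eps j' \<and> b = c - eps i'"
    using ij(1) by (auto simp: doubleton_eq_iff)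
  then have "i' = i \<and> j' = j \<or> j' = i \<and> i' = j"
    using uniq c' assms(2,3) by metis
  then show "i \<noteq> j" "i \<in> Supp c" "j \<in> Supp c" using ij by auto
  show "a = c - eps i" by (simp add: assms(2))
  show "b = c - eps j" by (simp add: assms(3))
qed

context
  fixes X :: "'n::{finite,linorder} \<Rightarrow> ('n \<Rightarrow>\<^sub>0 nat) \<Rightarrow> 'd::{finite,linorder} set"
begin

text \<open>Hook tableaux correspond to edges of the down-graph, and \<open>kappa\<close> acts as a
  boundary map, giving the difference of the basis elements at the two ends.\<close>

lemma kappa_hook_LS:
  assumes "i < j" "i \<in> Supp c" "j \<in> Supp c"
  shows "kappa (hook i j (c - eps i - eps j)) = std i (c - eps i) - std j (c - eps j)"
proof -
  have "c - eps i - eps j + eps j = c - eps i" "c - eps i - eps j + eps i = c - eps j"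
    using assms
    by (auto intro!: poly_mapping_eqI simp: lookup_add lookup_minus lookup_single when_def in_keys_iff)
  then show ?thesis by (simp only: kappa_hook[OF assms(1)])
qed

lemma tab_span_LS:
  assumes c: "c \<in> Delta (CARD('d) + 1)" and "{a, b} \<in> LS X c" "c = a + eps i" "c = b + eps j"
  shows "(std i a - std j b :: ('n, 'r::comm_ring_1) ext_sym) \<in> tab_span X"
proof -
  have less: "(std i a - std j b :: ('n, 'r) ext_sym) \<in> tab_span X"
    if "{a, b} \<in> LS X c" "c = a + eps i" "c = b + eps j" "i < j" for a b i j
  proof -
    note ij = LS_cases[OF that(1-3)]
    have "hook i j (c - eps i - eps j) \<in> (tab X :: ('n, 'r) ext_sym set)"
      unfolding tab_def using c ij that(1,4) by blast
    then have "kappa (hook i j (c - eps i - eps j)) \<in> (tab_span X :: ('n, 'r) ext_sym set)"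
      unfolding tab_span_def by (intro ext.span_base imageI)
    then show ?thesis
      unfolding kappa_hook_LS[OF that(4) ij(2,3)] unfolding ij(4,5)[symmetric] .
  qed
  \<comment> \<open>Hooks are listed with increasing indices only; the opposite orientation of an
    edge is the negative.\<close>
  consider "i < j" | "j < i" using LS_cases(1)[OF assms(2-4)] by force
  then show ?thesis
  proof cases
    case 1
    then show ?thesis using less assms by blast
  next
    case 2
    have "{b, a} \<in> LS X c" using assms(2) by (simp only: insert_commute)
    then have "(std j b - std i a :: ('n, 'r) ext_sym) \<in> tab_span X"
      by (rule less[OF _ assms(4,3) 2])
    then have "- (std j b - std i a :: ('n, 'r) ext_sym) \<in> tab_span X"
      unfolding tab_span_def by (rule ext.span_neg)
    then show ?thesis by simp
  qed
qed

lemma tab_span_connected: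
  assumes c: "c \<in> Delta (CARD('d) + 1)" and "(a, b) \<in> {(x, y). {x, y} \<in> LS X c}\<^sup>*"
    and "c = a + eps i" "c = b + eps j"
  shows "(std i a - std j b :: ('n, 'r::comm_ring_1) ext_sym) \<in> tab_span X"
  using assms(2,4)
proof (induction arbitrary: j)
  case base
  then have "lookup (eps i) i = lookup (eps j) i" using assms(3) by simp
  then have "i = j" by (simp add: lookup_single when_def split: if_splits)
  then show ?case by (simp add: tab_span_def ext.span_zero)
next
  case (step b b')
  then have edge: "{b, b'} \<in> LS X c" by simp
  then have "b \<in> down_verts c"
    by (auto simp: LS_def down_verts_def doubleton_eq_iff)
  then obtain l where l: "c = b + eps l" by (auto simp: down_verts_iff)
  have "(std i a - std l b) + (std l b - std j b') \<in> (tab_span X :: ('n, 'r) ext_sym set)"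
    using step.IH[OF l] tab_span_LS[OF c edge l step.prems] unfolding tab_span_def
    by (rule ext.span_add)
  then show ?case by simp
qed

lemma tab_span_subset: "tab_span X \<subseteq> (schur_L 1 CARD('d) :: ('n, 'r::comm_ring_1) ext_sym set)"
  unfolding tab_span_def
proof (rule ext.span_minimal[OF _ subspace_schur_L], rule image_subsetI)
  fix x :: "('n, 'r) ext_sym" assume "x \<in> tab X"
  then obtain c i j where x: "x = hook i j (c - eps i - eps j)"
    and c: "c \<in> Delta (CARD('d) + 1)" "i \<in> Supp c" "j \<in> Supp c" "i < j"
    unfolding tab_def by blast
  have "mdeg (c - eps i) = CARD('d)" "mdeg (c - eps j) = CARD('d)"
    using c(1) arg_cong[OF c(2)[unfolded Supp_add_eps], of mdeg] arg_cong[OF c(3)[unfolded Supp_add_eps], of mdeg]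
    by (simp_all add: Delta_iff mdeg_add)
  then show "kappa x \<in> schur_L 1 CARD('d)"
    unfolding x kappa_hook_LS[OF c(4,2,3)]
    by (rule schur_L_1_relation) (use c(2,3) in \<open>metis Supp_add_eps\<close>)
qed

text \<open>Every basis element is compared with a fixed one having the same image under
  \<open>kappa\<close>. By connectedness their difference is in the span, and for an element of the
  kernel the fixed parts cancel.\<close>

lemma schur_L_subset_tab_span:
  assumes conn: "\<And>c. c \<in> Delta (CARD('d) + 1) \<Longrightarrow> graph_connected (down_verts c) (LS X c)"
  shows "(schur_L 1 CARD('d) :: ('n, 'r::comm_ring_1) ext_sym set) \<subseteq> tab_span X"
proof
  fix x :: "('n, 'r) ext_sym" assume x: "x \<in> schur_L 1 CARD('d)"
  define rep :: "('n \<Rightarrow>\<^sub>0 nat) \<Rightarrow> ('n, 'r) ext_sym" where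
    "rep e = (SOME y. \<exists>i a. e = a + eps i \<and> y = std i a)" for e
  have rep: "\<exists>j b. a + eps i = b + eps j \<and> rep (a + eps i) = std j b" for a i
    unfolding rep_def by (rule someI_ex) blast
  \<comment> \<open>In exterior degree one \<open>kappa\<close> lands in degree zero, so the
    coefficient at \<open>{}\<close> is its whole value. \<open>g\<close> subtracts a chosen
    preimage of it and is the identity on the kernel.\<close>
  define g where "g y = y - lin scale rep (lookup (kappa y) {})" for y :: "('n, 'r) ext_sym"
  have "g (y + z) = g y + g z" for y z
    by (simp add: g_def kappa_add lookup_add ext.lin_add)
  moreover have "g 0 = 0"
    by (simp add: g_def kappa_zero ext.lin_zero)
  ultimately have g_sum: "g (sum f A) = (\<Sum>a\<in>A. g (f a))" for f and A :: "'b set"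
    by (induction A rule: infinite_finite_induct) simp_all
  have basis: "g (scale r (std i u)) \<in> tab_span X" if "mdeg u = CARD('d)" for r i u
  proof -
    have c: "u + eps i \<in> Delta (CARD('d) + 1)"
      using that by (simp add: Delta_iff mdeg_add)
    obtain j b where b: "u + eps i = b + eps j" "rep (u + eps i) = std j b"
      using rep by blast
    have "u \<in> down_verts (u + eps i)" "b \<in> down_verts (u + eps i)"
      using b(1) unfolding down_verts_iff by blast+
    then have "(u, b) \<in> {(x, y). {x, y} \<in> LS X (u + eps i)}\<^sup>*"
      using conn[OF c] unfolding graph_connected_def by blast
    then have "std i u - std j b \<in> (tab_span X :: ('n, 'r) ext_sym set)"
      by (rule tab_span_connected[OF c _ refl b(1)])
    then have "scale r (std i u - std j b) \<in> tab_span X"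
      unfolding tab_span_def by (rule ext.span_scale)
    moreover have "lookup (kappa (scale r (std i u))) {} = single (u + eps i) r"
      by (simp add: kappa_scale kappa_std lookup_scale single_eq_const_mon)
    ultimately show ?thesis
      by (simp only: g_def ext.lin_single b(2) ext.scale_right_diff_distrib)
  qed
  have "x = (\<Sum>A\<in>keys x. \<Sum>u\<in>keys (lookup x A). single A (single u (lookup (lookup x A) u)))"
  proof -
    have single_sum: "single A p = (\<Sum>u\<in>keys p. single A (single u (lookup p u)))" for A and p :: "('n, 'r) mpoly"
    proof -
      have "single A (sum f U) = (\<Sum>u\<in>U. single A (f u))" for f :: "'c \<Rightarrow> ('n, 'r) mpoly" and U
        by (induction U rule: infinite_finite_induct) (simp_all add: single_add)
      then show ?thesis by (metis poly_mapping_sum_single)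
    qed
    show ?thesis by (rule trans[OF poly_mapping_sum_single sum.cong[OF refl single_sum]])
  qed
  then have "g x = (\<Sum>A\<in>keys x. \<Sum>u\<in>keys (lookup x A). g (single A (single u (lookup (lookup x A) u))))"
    by (metis (no_types, lifting) g_sum sum.cong)
  also have "\<dots> \<in> tab_span X"
    unfolding tab_span_def
  proof (intro ext.span_sum)
    fix A u assume "A \<in> keys x" "u \<in> keys (lookup x A)"
    then have "card A = 1" "mdeg u = CARD('d)"
      using x by (auto simp: schur_L_def ext_sym_part_def)
    moreover from this obtain i where "A = {i}" by (auto simp: card_1_singleton_iff)
    ultimately show "g (single A (single u (lookup (lookup x A) u))) \<in> ext.span (kappa ` tab X)"
      using basis[of u "lookup (lookup x A) u" i]
      by (simp add: std_def scale_single tab_span_def flip: single_eq_const_mon)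
  qed
  finally show "x \<in> tab_span X"
    using x by (simp add: g_def schur_L_def ext.lin_zero)
qed

text \<open>The counterpart of \<open>connected_if_in_sigma_J\<close>: \<open>\<Phi>\<close> sums
  the coefficients at the vertices of one component, hence vanishes on differences along
  edges.\<close>

lemma connected_if_schur_L_subset:
  assumes sub: "(schur_L 1 CARD('d) :: ('n, 'r::comm_ring_1) ext_sym set) \<subseteq> tab_span X"
    and c: "c \<in> Delta (CARD('d) + 1)"
  shows "graph_connected (down_verts c) (LS X c)"
  unfolding graph_connected_def
proof (intro conjI ballI)
  show "down_verts c \<noteq> {}" using down_verts_nonempty[of c "CARD('d)"] c by simp
next
  fix a b assume "a \<in> down_verts c" "b \<in> down_verts c"
  then obtain i j where ij: "c = a + eps i" "c = b + eps j" unfolding down_verts_iff by blast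
  define C where "C = {v. (a, v) \<in> {(x, y). {x, y} \<in> LS X c}\<^sup>*}"
  \<comment> \<open>\<open>I\<close> lists the component by the index removed from \<open>c\<close>,
    since the vertex \<open>c - eps l\<close> carries the basis element
    \<open>std l (c - eps l)\<close>.\<close>
  define I where "I = {l \<in> Supp c. c - eps l \<in> C}"
  define \<Phi> where "\<Phi> x = (\<Sum>l\<in>I. lookup (lookup x {l}) (c - eps l))" for x :: "('n, 'r) ext_sym"
  have add: "\<Phi> (x + y) = \<Phi> x + \<Phi> y" for x y
    by (simp add: \<Phi>_def lookup_add sum.distrib)
  have diff: "\<Phi> (x - y) = \<Phi> x - \<Phi> y" for x y
    by (simp add: \<Phi>_def lookup_minus sum_subtractf)
  have scale: "\<Phi> (scale r x) = r * \<Phi> x" for r x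
    by (simp add: \<Phi>_def lookup_scale lookup_const_mult sum_distrib_left)
  have std: "\<Phi> (std l v) = (if c = v + eps l \<and> v \<in> C then 1 else 0)" for l v
  proof -
    have "\<Phi> (std l v) = (\<Sum>l'\<in>I. if l = l' then (if v = c - eps l then 1 else 0) else 0)"
      unfolding \<Phi>_def by (rule sum.cong) (auto simp: lookup_std)
    also have "\<dots> = (if l \<in> I \<and> v = c - eps l then 1 else 0)"
      by simp
    also have "l \<in> I \<and> v = c - eps l \<longleftrightarrow> c = v + eps l \<and> v \<in> C"
      unfolding I_def mem_Collect_eq Supp_add_eps by (metis add_diff_cancel_right')
    finally show ?thesis .
  qed
  have \<Phi>_span: "\<Phi> x = 0" if "x \<in> tab_span X" for x
    using that unfolding tab_span_def
  proof (induction rule: ext.span_induct_alt)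
    case base
    show ?case by (simp add: \<Phi>_def)
  next
    case (step r y x)
    then obtain c' l m where y: "y = kappa (hook l m (c' - eps l - eps m))"
      and lm: "l \<in> Supp c'" "m \<in> Supp c'" "l < m" and edge: "{c' - eps l, c' - eps m} \<in> LS X c'"
      unfolding tab_def by blast
    note c' = lm(1,2)[unfolded Supp_add_eps, symmetric]
    \<comment> \<open>The ends of an edge over \<open>c\<close> lie both inside or both outside the
      component; over another point \<open>c'\<close> both sides are false.\<close>
    have "c = c' - eps l + eps l \<and> c' - eps l \<in> C \<longleftrightarrow> c = c' - eps m + eps m \<and> c' - eps m \<in> C"
    proof (cases "c' = c")
      case True
      then have "(c' - eps l, c' - eps m) \<in> {(x, y). {x, y} \<in> LS X c}"
        "(c' - eps m, c' - eps l) \<in> {(x, y). {x, y} \<in> LS X c}"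
        using edge by (simp_all add: insert_commute)
      then have "c' - eps l \<in> C \<longleftrightarrow> c' - eps m \<in> C"
        unfolding C_def mem_Collect_eq by (blast intro: rtrancl_into_rtrancl)
      then show ?thesis by (simp only: c')
    next
      case False
      then show ?thesis by (simp only: c') blast
    qed
    then have "\<Phi> y = 0"
      unfolding y kappa_hook_LS[OF lm(3,1,2)] diff std by simp
    then show ?case using step(2) by (simp add: add scale)
  qed
  have "mdeg a = CARD('d)" "mdeg b = CARD('d)"
    using c[unfolded ij(1)] c[unfolded ij(2)] by (simp_all add: Delta_iff mdeg_add)
  then have "(std i a - std j b :: ('n, 'r) ext_sym) \<in> schur_L 1 CARD('d)"
    by (rule schur_L_1_relation) (use ij in metis)
  then have "\<Phi> (std i a - std j b) = 0" using sub \<Phi>_span by blast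
  moreover have "a \<in> C" by (simp add: C_def)
  ultimately have "b \<in> C"
    unfolding diff std using ij by (simp split: if_splits)
  then show "(a, b) \<in> {(x, y). {x, y} \<in> LS X c}\<^sup>*" by (simp add: C_def)
qed

lemma tab_span_eq_iff_connected:
  "(tab_span X :: ('n, 'r::comm_ring_1) ext_sym set) = schur_L 1 CARD('d) \<longleftrightarrow>
    (\<forall>c\<in>Delta (CARD('d) + 1). graph_connected (down_verts c) (LS X c))"
  using tab_span_subset schur_L_subset_tab_span connected_if_schur_L_subset by (metis subset_antisym subset_refl)

end

theorem theorem6p5:
  fixes X :: "'n::{finite,linorder} \<Rightarrow> ('n \<Rightarrow>\<^sub>0 nat) \<Rightarrow> 'd::{finite,linorder} set"
  assumes "\<And>i. rank_preserving_isotone i (X i)"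
  shows "((tab_span X :: ('n, ('v, 'k::field) mpoly) ext_sym set) = schur_L 1 CARD('d)
            \<longleftrightarrow> (\<forall>c\<in>Delta (CARD('d) + 1).
                   \<exists>T\<subseteq>LS X c. spanning_tree (down_verts c) (down_edges c) T)) \<and>
         ((\<forall>c\<in>Delta (CARD('d) + 1).
             \<exists>T\<subseteq>LS X c. spanning_tree (down_verts c) (down_edges c) T)
            \<longleftrightarrow> is_polarization (J_ideal X :: ('n \<times> 'd, 'k) mpoly set)
                  (ideal_power (ideal_gen (var ` UNIV)) CARD('d)))"
proof -
  have rank: "card (X i a) = lookup a i" if "a \<in> Delta CARD('d)" for i a
    using assms[of i] that by (simp add: rank_preserving_isotone_def)
  then have "is_polarization (J_ideal X :: ('n \<times> 'd, 'k) mpoly set) (ideal_power (ideal_gen (range var)) CARD('d))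
      \<longleftrightarrow> (\<forall>c\<in>Delta (CARD('d) + 1). graph_connected (down_verts c) (LS X c))"
    by (rule is_polarization_iff_connected)
  \<comment> \<open>The span is taken over a polynomial ring and the polarization over
    \<open>'k\<close>; connectedness mentions neither ring and so links the two.\<close>
  then show ?thesis
    by (simp only: spanning_tree_iff_connected[OF finite_down_edges LS_subset_down_edges]
        tab_span_eq_iff_connected)
qed

end
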